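(* Let $S$ be a generalized Krull domain and let $J$ be an ideal of $S$ having exactly $n$ minimal primes over it, where $n$ is an integer with $n\ge 2$. Assume further that $J$ has height at least two. Let $A$ be a subring of $S/J$ such that $S/J$ is integral over $A$ and the extension $A\subseteq S/J$ is fragile. Let $R$ be the pullback of $A\to S/J\leftarrow S$, i.e. $R=\{s\in S:\ s+J\in A\}$. Then $R$ is perinormal.
   Context: All rings are commutative with identity; "local" means having a unique maximal ideal (no Noetherian assumption). Generalized Krull domain: for a ring $R$ let $\operatorname{Spec}^1(R)$ be the set of height one primes. An integral domain $R$ is a generalized Krull domain if (1) $R=\bigcap_{\mathfrak p\in\operatorname{Spec}^1(R)}R_{\mathfrak p}$; (2) for each nonzero $r\in R$ the set $\{\mathfrak p\in\operatorname{Spec}^1(R): r\in\mathfrak p\}$ is finite; (3) $R_{\mathfrak p}$ is a (not necessarily discrete) valuation domain for every $\mathfrak p\in\operatorname{Spec}^1(R)$. Fragility: an integral extension $A\subseteq B$ of commutative rings is apparently fragile if for any ring $C$ with $A\subsetneq C\subseteq B$ there exist a minimal prime $\mathfrak p$ of $A$ and primes $P\ne Q$ of $C$ with $P\cap A=Q\cap A=\mathfrak p$ (the case $A=B$ being vacuously allowed). It is fragile if $A_P\subseteq B_{A\setminus P}$ is apparently fragile for every $P\in\operatorname{Spec}A$. Perinormality: an overring of an integral domain $R$ is a ring between $R$ and its fraction field. An extension $R\subseteq T$ satisfies going-down if whenever $\mathfrak p_1\subseteq\mathfrak p_2$ are primes of $R$ and $Q_2\in\operatorname{Spec}T$ satisfies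 $Q_2\cap R=\mathfrak p_2$, there is $Q_1\in\operatorname{Spec}T$ with $Q_1\subseteq Q_2$ and $Q_1\cap R=\mathfrak p_1$. An integral domain $R$ is perinormal if every local overring $L$ of $R$ such that $R\subseteq L$ satisfies going-down is a localization of $R$ (i.e. $L=R_{\mathfrak p}$ for some $\mathfrak p\in\operatorname{Spec}R$). *)

theory Defs
  imports "HOL-Algebra.Subrings" "HOL-Algebra.QuotRing" "HOL-Algebra.Divisibility" "HOL-Library.Extended_Nat"
begin

text \<open>
  A ring extension \<open>A \<subseteq> B\<close> is given by a ring record \<open>B\<close> together with the carrier set
  \<open>A\<close> of a subring; regarded as a ring in its own right, the latter is \<open>B\<lparr>carrier := A\<rparr>\<close>.
\<close>

definition Spec :: "('a, 'm) ring_scheme \<Rightarrow> 'a set set" where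
  "Spec R = {P. primeideal P R}"

definition minimal_primes_over :: "('a, 'm) ring_scheme \<Rightarrow> 'a set \<Rightarrow> 'a set set" where
  "minimal_primes_over R I =
     {P \<in> Spec R. I \<subseteq> P \<and> (\<forall>Q \<in> Spec R. I \<subseteq> Q \<and> Q \<subseteq> P \<longrightarrow> Q = P)}"

definition minimal_primes :: "('a, 'm) ring_scheme \<Rightarrow> 'a set set" where
  "minimal_primes R = minimal_primes_over R {\<zero>\<^bsub>R\<^esub>}"

definition prime_height :: "('a, 'm) ring_scheme \<Rightarrow> 'a set \<Rightarrow> enat" where
  "prime_height R P =
     Sup {enat n | n. \<exists>c :: nat \<Rightarrow> 'a set.
            (\<forall>i\<le>n. c i \<in> Spec R) \<and> (\<forall>i<n. c i \<subset> c (Suc i)) \<and> c n = P}"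

text \<open>The unit ideal gets height \<open>\<infinity>\<close>, the infimum of the empty set.\<close>

definition ideal_height :: "('a, 'm) ring_scheme \<Rightarrow> 'a set \<Rightarrow> enat" where
  "ideal_height R I = Inf (prime_height R ` {P \<in> Spec R. I \<subseteq> P})"

definition Spec1 :: "('a, 'm) ring_scheme \<Rightarrow> 'a set set" where
  "Spec1 R = {P \<in> Spec R. prime_height R P = 1}"

definition local_ring :: "('a, 'm) ring_scheme \<Rightarrow> bool" where
  "local_ring R \<longleftrightarrow> cring R \<and> (\<exists>!M. maximalideal M R)"

text \<open>\<open>loc_frac R M a s\<close> is the class of the fraction \<open>a / s\<close> in the localization of \<open>R\<close> at the
  multiplicative set \<open>M\<close>; zero divisors in \<open>M\<close> are allowed.\<close>

definition loc_frac :: "('a, 'm) ring_scheme \<Rightarrow> 'a set \<Rightarrow> 'a \<Rightarrow> 'a \<Rightarrow> ('a \<times> 'a) set" where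
  "loc_frac R M a s =
     {(b, t). b \<in> carrier R \<and> t \<in> M \<and>
        (\<exists>u \<in> M. u \<otimes>\<^bsub>R\<^esub> (a \<otimes>\<^bsub>R\<^esub> t) = u \<otimes>\<^bsub>R\<^esub> (b \<otimes>\<^bsub>R\<^esub> s))}"

definition fractions :: "('a, 'm) ring_scheme \<Rightarrow> 'a set \<Rightarrow> 'a set \<Rightarrow> 'a set \<Rightarrow> ('a \<times> 'a) set set" where
  "fractions R M A U = {loc_frac R M a s | a s. a \<in> A \<and> s \<in> U}"

definition localization :: "('a, 'm) ring_scheme \<Rightarrow> 'a set \<Rightarrow> ('a \<times> 'a) set ring" where
  "localization R M =
     \<lparr>carrier = fractions R M (carrier R) M,
      monoid.mult = (\<lambda>x y. \<Union>(a, s) \<in> x. \<Union>(b, t) \<in> y. loc_frac R M (a \<otimes>\<^bsub>R\<^esub> b) (s \<otimes>\<^bsub>R\<^esub> t)),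
      one = loc_frac R M \<one>\<^bsub>R\<^esub> \<one>\<^bsub>R\<^esub>,
      zero = loc_frac R M \<zero>\<^bsub>R\<^esub> \<one>\<^bsub>R\<^esub>,
      add = (\<lambda>x y. \<Union>(a, s) \<in> x. \<Union>(b, t) \<in> y.
               loc_frac R M ((a \<otimes>\<^bsub>R\<^esub> t) \<oplus>\<^bsub>R\<^esub> (b \<otimes>\<^bsub>R\<^esub> s)) (s \<otimes>\<^bsub>R\<^esub> t))\<rparr>"

context cring
begin

lemma loc_frac_eq_iff:
  assumes M: "submonoid M R" and "a \<in> carrier R" "b \<in> carrier R" "s \<in> M" "t \<in> M"
  shows "loc_frac R M a s = loc_frac R M b t \<longleftrightarrow>
           (\<exists>u \<in> M. u \<otimes> (a \<otimes> t) = u \<otimes> (b \<otimes> s))"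
proof
  interpret M: submonoid M R by (rule M)
  have sub: "\<And>x. x \<in> M \<Longrightarrow> x \<in> carrier R" using M.subset by blast
  have step: "loc_frac R M b' t' \<subseteq> loc_frac R M a' s'"
    if a': "a' \<in> carrier R" and b': "b' \<in> carrier R" and s': "s' \<in> M" and t': "t' \<in> M"
      and u: "u \<in> M" and e: "u \<otimes> (a' \<otimes> t') = u \<otimes> (b' \<otimes> s')" for a' b' s' t' u
  proof (clarsimp simp: loc_frac_def)
    fix c v w
    assume c: "c \<in> carrier R" and v: "v \<in> M" and w: "w \<in> M"
      and e2: "w \<otimes> (b' \<otimes> v) = w \<otimes> (c \<otimes> t')"
    have cl: "u \<in> carrier R" "s' \<in> carrier R" "t' \<in> carrier R" "v \<in> carrier R" "w \<in> carrier R"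
      using u s' t' v w sub by auto
    have "(u \<otimes> w \<otimes> t') \<otimes> (a' \<otimes> v) = (w \<otimes> v) \<otimes> (u \<otimes> (a' \<otimes> t'))"
      using a' cl by (simp add: m_ac)
    also have "\<dots> = (u \<otimes> s') \<otimes> (w \<otimes> (b' \<otimes> v))"
      unfolding e using b' cl by (simp add: m_ac)
    also have "\<dots> = (u \<otimes> w \<otimes> t') \<otimes> (c \<otimes> s')"
      unfolding e2 using c cl by (simp add: m_ac)
    finally have "(u \<otimes> w \<otimes> t') \<otimes> (a' \<otimes> v) = (u \<otimes> w \<otimes> t') \<otimes> (c \<otimes> s')" .
    thus "\<exists>x\<in>M. x \<otimes> (a' \<otimes> v) = x \<otimes> (c \<otimes> s')"
      using u w t' by (intro bexI[of _ "u \<otimes> w \<otimes> t'"]) auto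
  qed
  show "\<exists>u \<in> M. u \<otimes> (a \<otimes> t) = u \<otimes> (b \<otimes> s)" if eq: "loc_frac R M a s = loc_frac R M b t"
  proof -
    have "(b, t) \<in> loc_frac R M b t"
      using assms by (auto simp: loc_frac_def intro!: bexI[of _ \<one>])
    hence "(b, t) \<in> loc_frac R M a s" using eq by simp
    thus ?thesis by (auto simp: loc_frac_def)
  qed
  show "loc_frac R M a s = loc_frac R M b t" if "\<exists>u \<in> M. u \<otimes> (a \<otimes> t) = u \<otimes> (b \<otimes> s)"
  proof -
    from that obtain u where u: "u \<in> M" "u \<otimes> (a \<otimes> t) = u \<otimes> (b \<otimes> s)" by blast
    show ?thesis
      using step[OF assms(2,3,4,5) u] step[OF assms(3,2,5,4) u(1) u(2)[symmetric]] by blast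
  qed
qed

lemma mem_loc_frac_iff:
  assumes "submonoid M R" "a \<in> carrier R" "s \<in> M"
  shows "(b, t) \<in> loc_frac R M a s \<longleftrightarrow>
           b \<in> carrier R \<and> t \<in> M \<and> loc_frac R M b t = loc_frac R M a s"
  using loc_frac_eq_iff[of M a b s t] assms by (auto simp: loc_frac_def)

lemma loc_frac_op:
  assumes M: "submonoid M R" and "a \<in> carrier R" "s \<in> M" "b \<in> carrier R" "t \<in> M"
  shows loc_frac_mult: "loc_frac R M a s \<otimes>\<^bsub>localization R M\<^esub> loc_frac R M b t =
           loc_frac R M (a \<otimes> b) (s \<otimes> t)"
    and loc_frac_add: "loc_frac R M a s \<oplus>\<^bsub>localization R M\<^esub> loc_frac R M b t =
           loc_frac R M (a \<otimes> t \<oplus> b \<otimes> s) (s \<otimes> t)"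
proof -
  interpret M: submonoid M R by (rule M)
  have sub: "\<And>x. x \<in> M \<Longrightarrow> x \<in> carrier R" using M.subset by blast
  have wd: "loc_frac R M (a' \<otimes> b') (s' \<otimes> t') = loc_frac R M (a \<otimes> b) (s \<otimes> t) \<and>
      loc_frac R M (a' \<otimes> t' \<oplus> b' \<otimes> s') (s' \<otimes> t') = loc_frac R M (a \<otimes> t \<oplus> b \<otimes> s) (s \<otimes> t)"
    if x: "(a', s') \<in> loc_frac R M a s" and y: "(b', t') \<in> loc_frac R M b t" for a' s' b' t'
  proof -
    from x obtain u where u: "a' \<in> carrier R" "s' \<in> M" "u \<in> M" "u \<otimes> (a \<otimes> s') = u \<otimes> (a' \<otimes> s)"
      by (auto simp: loc_frac_def)
    from y obtain v where v: "b' \<in> carrier R" "t' \<in> M" "v \<in> M" "v \<otimes> (b \<otimes> t') = v \<otimes> (b' \<otimes> t)"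
      by (auto simp: loc_frac_def)
    have cl: "u \<in> carrier R" "v \<in> carrier R" "s \<in> carrier R" "t \<in> carrier R"
       "s' \<in> carrier R" "t' \<in> carrier R" "a \<in> carrier R" "b \<in> carrier R"
       "a' \<in> carrier R" "b' \<in> carrier R"
      using u v assms sub by auto
    have "(u \<otimes> v) \<otimes> ((a' \<otimes> b') \<otimes> (s \<otimes> t)) = (u \<otimes> (a' \<otimes> s)) \<otimes> (v \<otimes> (b' \<otimes> t))"
      using cl by (simp add: m_ac)
    also have "\<dots> = (u \<otimes> (a \<otimes> s')) \<otimes> (v \<otimes> (b \<otimes> t'))"
      using u v by simp
    also have "\<dots> = (u \<otimes> v) \<otimes> ((a \<otimes> b) \<otimes> (s' \<otimes> t'))"
      using cl by (simp add: m_ac)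
    finally have 1: "(u \<otimes> v) \<otimes> ((a' \<otimes> b') \<otimes> (s \<otimes> t)) = (u \<otimes> v) \<otimes> ((a \<otimes> b) \<otimes> (s' \<otimes> t'))" .
    have "(u \<otimes> v) \<otimes> ((a' \<otimes> t' \<oplus> b' \<otimes> s') \<otimes> (s \<otimes> t))
        = (v \<otimes> t \<otimes> t') \<otimes> (u \<otimes> (a' \<otimes> s)) \<oplus> (u \<otimes> s \<otimes> s') \<otimes> (v \<otimes> (b' \<otimes> t))"
      using cl by (simp add: m_ac r_distr l_distr)
    also have "\<dots> = (v \<otimes> t \<otimes> t') \<otimes> (u \<otimes> (a \<otimes> s')) \<oplus> (u \<otimes> s \<otimes> s') \<otimes> (v \<otimes> (b \<otimes> t'))"
      using u v by simp
    also have "\<dots> = (u \<otimes> v) \<otimes> ((a \<otimes> t \<oplus> b \<otimes> s) \<otimes> (s' \<otimes> t'))"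
      using cl by (simp add: m_ac r_distr l_distr)
    finally have 2: "(u \<otimes> v) \<otimes> ((a' \<otimes> t' \<oplus> b' \<otimes> s') \<otimes> (s \<otimes> t)) =
       (u \<otimes> v) \<otimes> ((a \<otimes> t \<oplus> b \<otimes> s) \<otimes> (s' \<otimes> t'))" .
    have uv: "u \<otimes> v \<in> M" "s \<otimes> t \<in> M" "s' \<otimes> t' \<in> M" using u v assms by auto
    show ?thesis
      using cl uv 1 2 by (subst (1 2) loc_frac_eq_iff[OF M]) auto
  qed
  have mem: "(a, s) \<in> loc_frac R M a s" "(b, t) \<in> loc_frac R M b t"
    using assms by (auto simp: mem_loc_frac_iff)
  have const: "(\<Union>(a', s') \<in> U. \<Union>(b', t') \<in> V. F a' s' b' t') = c"
    if "\<And>a' s' b' t'. (a', s') \<in> U \<Longrightarrow> (b', t') \<in> V \<Longrightarrow> F a' s' b' t' = c"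
      and "(a, s) \<in> U" and "(b, t) \<in> V"
    for U V and F :: "'a \<Rightarrow> 'a \<Rightarrow> 'a \<Rightarrow> 'a \<Rightarrow> ('a \<times> 'a) set" and c
  proof (rule subset_antisym)
    show "(\<Union>(a', s') \<in> U. \<Union>(b', t') \<in> V. F a' s' b' t') \<subseteq> c"
      using that(1) by auto
    show "c \<subseteq> (\<Union>(a', s') \<in> U. \<Union>(b', t') \<in> V. F a' s' b' t')"
      using that(1)[OF that(2,3)] that(2,3) by fast
  qed
  show "loc_frac R M a s \<otimes>\<^bsub>localization R M\<^esub> loc_frac R M b t = loc_frac R M (a \<otimes> b) (s \<otimes> t)"
    unfolding localization_def monoid.simps using wd by (intro const[OF _ mem]) blast
  show "loc_frac R M a s \<oplus>\<^bsub>localization R M\<^esub> loc_frac R M b t =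
           loc_frac R M (a \<otimes> t \<oplus> b \<otimes> s) (s \<otimes> t)"
    unfolding localization_def ring.simps using wd by (intro const[OF _ mem]) blast
qed

lemma localization_cring:
  assumes M: "submonoid M R"
  shows "cring (localization R M)"
proof -
  interpret M: submonoid M R by (rule M)
  have sub: "\<And>x. x \<in> M \<Longrightarrow> x \<in> carrier R" using M.subset by blast
  let ?L = "localization R M" and ?f = "loc_frac R M"
  have one: "\<one>\<^bsub>?L\<^esub> = ?f \<one> \<one>" and zero: "\<zero>\<^bsub>?L\<^esub> = ?f \<zero> \<one>"
    by (simp_all add: localization_def)
  have frac: "?f a s \<in> carrier ?L" if "a \<in> carrier R" "s \<in> M" for a s
    using that by (auto simp: localization_def fractions_def)
  have cases: thesis
    if "x \<in> carrier ?L" "\<And>a s. a \<in> carrier R \<Longrightarrow> s \<in> M \<Longrightarrow> s \<in> carrier R \<Longrightarrow> x = ?f a s \<Longrightarrow> thesis"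
    for x thesis
    using that sub by (auto simp: localization_def fractions_def)
  have eqI: "?f a s = ?f b t"
    if "a \<otimes> t = b \<otimes> s" "a \<in> carrier R" "b \<in> carrier R" "s \<in> M" "t \<in> M" for a s b t
    using that loc_frac_eq_iff[OF M, of a b s t] M.one_closed by auto
  note ops = loc_frac_mult[OF M] loc_frac_add[OF M]
  note ac = m_ac a_ac r_distr l_distr
  show ?thesis
  proof (rule cringI)
    show "abelian_group ?L"
    proof (rule abelian_groupI)
      fix x y assume "x \<in> carrier ?L" "y \<in> carrier ?L"
      then show "x \<oplus>\<^bsub>?L\<^esub> y \<in> carrier ?L"
        by (elim cases) (simp add: ops frac)
    next
      show "\<zero>\<^bsub>?L\<^esub> \<in> carrier ?L" by (simp add: zero frac)
    next
      fix x y z assume "x \<in> carrier ?L" "y \<in> carrier ?L" "z \<in> carrier ?L"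
      then show "x \<oplus>\<^bsub>?L\<^esub> y \<oplus>\<^bsub>?L\<^esub> z = x \<oplus>\<^bsub>?L\<^esub> (y \<oplus>\<^bsub>?L\<^esub> z)"
        by (elim cases) (simp add: ops, rule eqI, simp_all add: ac)
    next
      fix x y assume "x \<in> carrier ?L" "y \<in> carrier ?L"
      then show "x \<oplus>\<^bsub>?L\<^esub> y = y \<oplus>\<^bsub>?L\<^esub> x"
        by (elim cases) (simp add: ops, rule eqI, simp_all add: ac)
    next
      fix x assume "x \<in> carrier ?L"
      then show "\<zero>\<^bsub>?L\<^esub> \<oplus>\<^bsub>?L\<^esub> x = x"
        by (elim cases) (simp add: ops zero)
    next
      fix x assume "x \<in> carrier ?L"
      then obtain a s where x: "a \<in> carrier R" "s \<in> M" "s \<in> carrier R" "x = ?f a s"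
        by (elim cases)
      have "?f (\<ominus> a) s \<oplus>\<^bsub>?L\<^esub> x = ?f ((\<ominus> a) \<otimes> s \<oplus> a \<otimes> s) (s \<otimes> s)"
        using x by (simp add: ops)
      also have "\<dots> = \<zero>\<^bsub>?L\<^esub>"
        unfolding zero using x by (intro eqI) (simp_all add: l_minus l_neg)
      finally show "\<exists>y\<in>carrier ?L. y \<oplus>\<^bsub>?L\<^esub> x = \<zero>\<^bsub>?L\<^esub>"
        using x frac by (intro bexI[of _ "?f (\<ominus> a) s"]) auto
    qed
    show "comm_monoid ?L"
    proof (rule comm_monoidI)
      fix x y assume "x \<in> carrier ?L" "y \<in> carrier ?L"
      then show "x \<otimes>\<^bsub>?L\<^esub> y \<in> carrier ?L"
        by (elim cases) (simp add: ops frac)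
    next
      show "\<one>\<^bsub>?L\<^esub> \<in> carrier ?L" by (simp add: one frac)
    next
      fix x y z assume "x \<in> carrier ?L" "y \<in> carrier ?L" "z \<in> carrier ?L"
      then show "x \<otimes>\<^bsub>?L\<^esub> y \<otimes>\<^bsub>?L\<^esub> z = x \<otimes>\<^bsub>?L\<^esub> (y \<otimes>\<^bsub>?L\<^esub> z)"
        by (elim cases) (simp add: ops m_assoc)
    next
      fix x assume "x \<in> carrier ?L"
      then show "\<one>\<^bsub>?L\<^esub> \<otimes>\<^bsub>?L\<^esub> x = x"
        by (elim cases) (simp add: ops one)
    next
      fix x y assume "x \<in> carrier ?L" "y \<in> carrier ?L"
      then show "x \<otimes>\<^bsub>?L\<^esub> y = y \<otimes>\<^bsub>?L\<^esub> x"
        by (elim cases) (simp add: ops m_comm)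
    qed
    fix x y z assume "x \<in> carrier ?L" "y \<in> carrier ?L" "z \<in> carrier ?L"
    then show "(x \<oplus>\<^bsub>?L\<^esub> y) \<otimes>\<^bsub>?L\<^esub> z = x \<otimes>\<^bsub>?L\<^esub> z \<oplus>\<^bsub>?L\<^esub> y \<otimes>\<^bsub>?L\<^esub> z"
      by (elim cases) (simp add: ops, rule eqI, simp_all add: ac)
  qed
qed

end

definition Frac :: "('a, 'm) ring_scheme \<Rightarrow> ('a \<times> 'a) set ring" where
  "Frac R = localization R (carrier R - {\<zero>\<^bsub>R\<^esub>})"

text \<open>The copy of \<open>R\<close> inside \<open>Frac R\<close>.\<close>

definition in_Frac :: "('a, 'm) ring_scheme \<Rightarrow> ('a \<times> 'a) set set" where
  "in_Frac R = fractions R (carrier R - {\<zero>\<^bsub>R\<^esub>}) (carrier R) {\<one>\<^bsub>R\<^esub>}"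

text \<open>\<open>R\<^bsub>P\<^esub>\<close> as a subring of \<open>Frac R\<close>.\<close>

definition loc_at :: "('a, 'm) ring_scheme \<Rightarrow> 'a set \<Rightarrow> ('a \<times> 'a) set set" where
  "loc_at R P = fractions R (carrier R - {\<zero>\<^bsub>R\<^esub>}) (carrier R) (carrier R - P)"

definition valuation_domain :: "('a, 'm) ring_scheme \<Rightarrow> bool" where
  "valuation_domain V \<longleftrightarrow>
     domain V \<and> (\<forall>a \<in> carrier V. \<forall>b \<in> carrier V. a divides\<^bsub>V\<^esub> b \<or> b divides\<^bsub>V\<^esub> a)"

text \<open>The intersection is formed inside \<open>Frac R\<close>; it is all of \<open>Frac R\<close> when \<open>R\<close> has no prime
  of height one.\<close>

definition generalized_Krull_domain :: "('a, 'm) ring_scheme \<Rightarrow> bool" where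
  "generalized_Krull_domain R \<longleftrightarrow>
     domain R \<and>
     in_Frac R = carrier (Frac R) \<inter> (\<Inter>P \<in> Spec1 R. loc_at R P) \<and>
     (\<forall>r \<in> carrier R - {\<zero>\<^bsub>R\<^esub>}. finite {P \<in> Spec1 R. r \<in> P}) \<and>
     (\<forall>P \<in> Spec1 R. valuation_domain ((Frac R)\<lparr>carrier := loc_at R P\<rparr>))"

definition integral_over :: "('a, 'm) ring_scheme \<Rightarrow> 'a set \<Rightarrow> 'a \<Rightarrow> bool" where
  "integral_over B A x \<longleftrightarrow>
     (\<exists>(n::nat) c. (\<forall>i<n. c i \<in> A) \<and>
        x [^]\<^bsub>B\<^esub> n \<oplus>\<^bsub>B\<^esub> (\<Oplus>\<^bsub>B\<^esub> i \<in> {..<n}. c i \<otimes>\<^bsub>B\<^esub> x [^]\<^bsub>B\<^esub> i) = \<zero>\<^bsub>B\<^esub>)"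

definition integral_extension :: "'a set \<Rightarrow> ('a, 'm) ring_scheme \<Rightarrow> bool" where
  "integral_extension A B \<longleftrightarrow>
     cring B \<and> subring A B \<and> (\<forall>x \<in> carrier B. integral_over B A x)"

definition apparently_fragile :: "'a set \<Rightarrow> ('a, 'm) ring_scheme \<Rightarrow> bool" where
  "apparently_fragile A B \<longleftrightarrow>
     integral_extension A B \<and>
     (\<forall>C. subring C B \<and> A \<subset> C \<longrightarrow>
        (\<exists>\<pp> \<in> minimal_primes (B\<lparr>carrier := A\<rparr>).
          \<exists>P \<in> Spec (B\<lparr>carrier := C\<rparr>). \<exists>Q \<in> Spec (B\<lparr>carrier := C\<rparr>).
            P \<noteq> Q \<and> P \<inter> A = \<pp> \<and> Q \<inter> A = \<pp>))"

text \<open>With \<open>M = A - P\<close>, the localization \<open>A\<^bsub>P\<^esub>\<close> is identified with its (isomorphic) image in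
  the localization of \<open>B\<close> at \<open>M\<close>, i.e. the fractions with numerator in \<open>A\<close>.\<close>

definition fragile :: "'a set \<Rightarrow> ('a, 'm) ring_scheme \<Rightarrow> bool" where
  "fragile A B \<longleftrightarrow>
     integral_extension A B \<and>
     (\<forall>P \<in> Spec (B\<lparr>carrier := A\<rparr>).
        apparently_fragile (fractions B (A - P) A (A - P)) (localization B (A - P)))"

definition overring :: "('a, 'm) ring_scheme \<Rightarrow> ('a \<times> 'a) set set \<Rightarrow> bool" where
  "overring R L \<longleftrightarrow> subring L (Frac R) \<and> in_Frac R \<subseteq> L"

definition going_down :: "'a set \<Rightarrow> ('a, 'm) ring_scheme \<Rightarrow> bool" where
  "going_down A T \<longleftrightarrow>
     (\<forall>p1 \<in> Spec (T\<lparr>carrier := A\<rparr>). \<forall>p2 \<in> Spec (T\<lparr>carrier := A\<rparr>). \<forall>Q2 \<in> Spec T.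
        p1 \<subseteq> p2 \<and> Q2 \<inter> A = p2 \<longrightarrow> (\<exists>Q1 \<in> Spec T. Q1 \<subseteq> Q2 \<and> Q1 \<inter> A = p1))"

definition perinormal :: "('a, 'm) ring_scheme \<Rightarrow> bool" where
  "perinormal R \<longleftrightarrow>
     domain R \<and>
     (\<forall>L. overring R L \<and> local_ring ((Frac R)\<lparr>carrier := L\<rparr>) \<and>
          going_down (in_Frac R) ((Frac R)\<lparr>carrier := L\<rparr>)
        \<longrightarrow> (\<exists>P \<in> Spec R. L = loc_at R P))"

definition pullback :: "('a, 'm) ring_scheme \<Rightarrow> 'a set \<Rightarrow> 'a set set \<Rightarrow> 'a set" where
  "pullback S J A = {s \<in> carrier S. J +>\<^bsub>S\<^esub> s \<in> A}"

end

theory Submission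
  imports Defs
begin

text \<open>
  Let \<open>L\<close> be a local overring with maximal ideal \<open>m\<close> for which going-down holds, and
  \<open>p = m \<inter> R\<close>. A height one prime \<open>q\<close> of \<open>S\<close> does not contain \<open>J\<close>, so \<open>R\<close> and \<open>S\<close> have the same
  localization, a valuation ring, at \<open>q\<close>. If \<open>q \<inter> R \<subseteq> p\<close>, going-down provides a prime of \<open>L\<close> over
  \<open>q \<inter> R\<close>, which forces \<open>L \<subseteq> S\<^bsub>q\<^esub>\<close>. Intersecting over these \<open>q\<close> gives
  \<open>R\<^bsub>p\<^esub> \<subseteq> L \<subseteq> S\<^bsub>R - p\<^esub>\<close>. If \<open>J\<close> is not contained in \<open>p\<close>, both bounds agree.

  Otherwise suppose \<open>L \<noteq> R\<^bsub>p\<^esub>\<close>. Fragility, applied to the image of \<open>L\<close> in the localization of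
  \<open>S / J\<close>, yields primes \<open>P \<noteq> Q\<close> of \<open>L\<close> with \<open>P \<inter> R = Q \<inter> R\<close>; say \<open>c \<in> S\<close> lies in \<open>P\<close> but not
  in \<open>Q\<close>. By integrality \<open>c\<close> is a nonunit of \<open>S\<^bsub>L - P\<^esub>\<close>, hence lies in a height one prime \<open>q\<close>
  of \<open>S\<close> with \<open>q \<inter> L \<subseteq> P\<close>. Going-down below \<open>Q\<close> gives a prime \<open>Q1 \<subseteq> Q\<close> over \<open>q \<inter> R\<close>; since
  \<open>J\<close> is not contained in \<open>q\<close>, this \<open>Q1\<close> contains \<open>c\<close>, a contradiction.
\<close>

section \<open>Primes of subrings and local rings\<close>

lemma (in cring) subring_cring:
  assumes "subring A R" shows "cring (R\<lparr>carrier := A\<rparr>)"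
  using subcring_iff[OF subringE(1)[OF assms]] subcringI'[OF assms] by simp

text \<open>Negatives are multiples by \<open>\<ominus> \<one> \<in> A\<close>, so these elementwise
  conditions already give an ideal. Primes of the various subrings are thereby described by the
  operations of the one ambient ring.\<close>

lemma (in cring) Spec_subring_iff:
  assumes A: "subring A R"
  shows "P \<in> Spec (R\<lparr>carrier := A\<rparr>) \<longleftrightarrow>
    P \<subseteq> A \<and> \<zero> \<in> P \<and> \<one> \<notin> P \<and> (\<forall>x\<in>P. \<forall>y\<in>P. x \<oplus> y \<in> P) \<and>
    (\<forall>x\<in>P. \<forall>a\<in>A. a \<otimes> x \<in> P) \<and> (\<forall>a\<in>A. \<forall>b\<in>A. a \<otimes> b \<in> P \<longrightarrow> a \<in> P \<or> b \<in> P)"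
    (is "?l \<longleftrightarrow> ?r")
proof
  assume ?l
  then interpret P: primeideal P "R\<lparr>carrier := A\<rparr>" by (simp add: Spec_def)
  have "\<one> \<notin> P" using P.one_imp_carrier P.I_notcarr by auto
  moreover have "P \<subseteq> A" using P.a_subset by simp
  moreover have "\<zero> \<in> P" using additive_subgroup.zero_closed[OF P.additive_subgroup_axioms] by simp
  ultimately show ?r using additive_subgroup.a_closed[OF P.additive_subgroup_axioms] P.I_l_closed P.I_prime by simp
next
  assume r: ?r
  have Ac: "A \<subseteq> carrier R" by (rule subringE(1)[OF A])
  have cr: "cring (R\<lparr>carrier := A\<rparr>)"
    by (rule subring_cring[OF A])
  show ?l unfolding Spec_def mem_Collect_eq
  proof (rule primeidealI)
    show "ideal P (R\<lparr>carrier := A\<rparr>)"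
    proof (rule idealI)
      show "ring (R\<lparr>carrier := A\<rparr>)" by (rule cring.axioms(1)[OF cr])
      have "subgroup P (add_monoid R)"
      proof (rule add.subgroupI)
        show "P \<subseteq> carrier R" using r Ac by blast
        show "P \<noteq> {}" using r by blast
        fix a assume a: "a \<in> P"
        have "\<ominus> \<one> \<otimes> a \<in> P"
          using r a subringE(5)[OF A subringE(3)[OF A]] by blast
        then show "\<ominus> a \<in> P"
          using a r Ac l_minus[of \<one> a] by auto
      qed (use r in auto)
      then show "subgroup P (add_monoid (R\<lparr>carrier := A\<rparr>))"
        using add.subgroup_incl[of P A] subring.axioms(1)[OF A] r by simp
      fix a x assume "a \<in> P" "x \<in> carrier (R\<lparr>carrier := A\<rparr>)"
      moreover then have "a \<otimes> x = x \<otimes> a" using r Ac m_comm[of a x] by auto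
      ultimately show "x \<otimes>\<^bsub>R\<lparr>carrier := A\<rparr>\<^esub> a \<in> P" "a \<otimes>\<^bsub>R\<lparr>carrier := A\<rparr>\<^esub> x \<in> P"
        using r by simp_all
    qed
    show "carrier (R\<lparr>carrier := A\<rparr>) \<noteq> P" using r subringE(3)[OF A] by auto
  qed (use r cr in simp_all)
qed

lemma (in cring) Spec_iff:
  "P \<in> Spec R \<longleftrightarrow>
    P \<subseteq> carrier R \<and> \<zero> \<in> P \<and> \<one> \<notin> P \<and> (\<forall>x\<in>P. \<forall>y\<in>P. x \<oplus> y \<in> P) \<and>
    (\<forall>x\<in>P. \<forall>a\<in>carrier R. a \<otimes> x \<in> P) \<and>
    (\<forall>a\<in>carrier R. \<forall>b\<in>carrier R. a \<otimes> b \<in> P \<longrightarrow> a \<in> P \<or> b \<in> P)"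
  using Spec_subring_iff[OF carrier_is_subring, of P] by simp

lemma (in cring) Spec_subring_mult_iff:
  assumes A: "subring A R" and P: "P \<in> Spec (R\<lparr>carrier := A\<rparr>)" and ab: "a \<in> A" "b \<in> A"
  shows "a \<otimes> b \<in> P \<longleftrightarrow> a \<in> P \<or> b \<in> P"
proof -
  have "a \<otimes> b = b \<otimes> a" using ab subringE(1)[OF A] by (auto intro: m_comm)
  then show ?thesis using P[unfolded Spec_subring_iff[OF A]] ab by metis
qed

lemma (in cring) Spec_contract:
  assumes A: "subring A R" and B: "subring B R" and "A \<subseteq> B" and P: "P \<in> Spec (R\<lparr>carrier := B\<rparr>)"
  shows "P \<inter> A \<in> Spec (R\<lparr>carrier := A\<rparr>)"
  using P[unfolded Spec_subring_iff[OF B]] assms(3) subringE(2,3,6,7)[OF A]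
  unfolding Spec_subring_iff[OF A]
  by (intro conjI ballI impI) (simp_all add: subset_iff)

text \<open>Zorn's lemma for the ideals over \<open>I\<close> that avoid \<open>\<one>\<close>: the
  union of a nonempty chain stays among them, and a maximal member is a maximal ideal because an
  ideal containing \<open>\<one>\<close> is the whole ring.\<close>

lemma (in cring) ideal_in_maximalideal:
  assumes "ideal I R" "\<one> \<notin> I"
  obtains M where "maximalideal M R" "I \<subseteq> M"
proof -
  let ?F = "{N. ideal N R \<and> I \<subseteq> N \<and> \<one> \<notin> N}"
  have "\<exists>M\<in>?F. \<forall>X\<in>?F. M \<subseteq> X \<longrightarrow> X = M"
  proof (rule subset_Zorn)
    fix C assume C: "subset.chain ?F C"
    show "\<exists>U\<in>?F. \<forall>X\<in>C. X \<subseteq> U"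
    proof (cases "C = {}")
      case True then show ?thesis using assms by auto
    next
      case False
      have id: "ideal N R" "I \<subseteq> N" "\<one> \<notin> N" if "N \<in> C" for N
        using C that by (auto simp: subset.chain_def)
      have tot: "M \<subseteq> N \<or> N \<subseteq> M" if "M \<in> C" "N \<in> C" for M N
        using C that by (auto simp: subset.chain_def)
      have sub: "additive_subgroup N R" if "N \<in> C" for N
        using id(1)[OF that] by (rule ideal.axioms(1))
      have "ideal (\<Union>C) R"
      proof (rule idealI[OF ring_axioms])
        show "subgroup (\<Union>C) (add_monoid R)"
        proof (rule add.subgroupI)
          show "\<Union>C \<subseteq> carrier R"
            using additive_subgroup.a_subset[OF sub] by blast
          from False obtain N where "N \<in> C" by blast
          then show "\<Union>C \<noteq> {}"
            using additive_subgroup.zero_closed[OF sub] by blast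
        next
          fix a assume "a \<in> \<Union>C"
          then obtain N where N: "N \<in> C" "a \<in> N" by blast
          from additive_subgroup.a_inv_closed[OF sub[OF N(1)] N(2)] show "\<ominus> a \<in> \<Union>C"
            using N(1) by blast
        next
          fix a b assume "a \<in> \<Union>C" "b \<in> \<Union>C"
          then obtain M N where MN: "M \<in> C" "a \<in> M" "N \<in> C" "b \<in> N" by blast
          then obtain N' where N: "N' \<in> C" "a \<in> N'" "b \<in> N'" using tot[of M N] by blast
          from additive_subgroup.a_closed[OF sub[OF N(1)] N(2,3)] N(1)
          show "a \<oplus> b \<in> \<Union>C" by auto
        qed
      next
        fix a x assume "a \<in> \<Union>C" and x: "x \<in> carrier R"
        then obtain N where N: "N \<in> C" "a \<in> N" by blast
        show "x \<otimes> a \<in> \<Union>C" "a \<otimes> x \<in> \<Union>C"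
          using ideal.I_l_closed[OF id(1)[OF N(1)] N(2) x]
            ideal.I_r_closed[OF id(1)[OF N(1)] N(2) x] N(1) by auto
      qed
      moreover from False obtain N where N: "N \<in> C" by blast
      then have "I \<subseteq> \<Union>C" using id(2)[OF N] by blast
      moreover have "\<one> \<notin> \<Union>C" using id(3) by blast
      ultimately show ?thesis by blast
    qed
  qed
  then obtain M where "M \<in> ?F" and max: "\<forall>X\<in>?F. M \<subseteq> X \<longrightarrow> X = M" by (elim bexE)
  then have M: "ideal M R" "I \<subseteq> M" "\<one> \<notin> M" by simp_all
  have "maximalideal M R"
  proof (rule maximalidealI[OF M(1)])
    show "carrier R \<noteq> M" using M(3) by auto
    fix N assume N: "ideal N R" "M \<subseteq> N" "N \<subseteq> carrier R"
    show "N = M \<or> N = carrier R"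
    proof (cases "\<one> \<in> N")
      case True
      then show ?thesis using ideal.one_imp_carrier[OF N(1)] by simp
    next
      case False
      then show ?thesis using max N M(2) by auto
    qed
  qed
  then show ?thesis using that M(2) by blast
qed

text \<open>A nonunit generates a proper ideal, which lies in some maximal ideal, that is, in the
  only one.\<close>

lemma (in cring) local_ring_prime_of_nonunits:
  assumes "local_ring R"
  obtains M where "M \<in> Spec R" "\<And>x. x \<in> carrier R \<Longrightarrow> x \<notin> M \<Longrightarrow> \<exists>y\<in>carrier R. x \<otimes> y = \<one>"
proof -
  from assms obtain M where M: "maximalideal M R" and un: "\<And>N. maximalideal N R \<Longrightarrow> N = M"
    unfolding local_ring_def by blast
  show ?thesis
  proof (rule that)
    show "M \<in> Spec R" using maximalideal_prime[OF M] by (simp add: Spec_def)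
    fix x assume x: "x \<in> carrier R" "x \<notin> M"
    show "\<exists>y\<in>carrier R. x \<otimes> y = \<one>"
    proof (rule ccontr)
      assume no: "\<not> ?thesis"
      then have "\<one> \<notin> PIdl x" using x m_comm unfolding cgenideal_def by force
      then obtain N where "maximalideal N R" "PIdl x \<subseteq> N"
        using ideal_in_maximalideal[OF cgenideal_ideal[OF x(1)]] by blast
      then show False using un x cgenideal_self[OF x(1)] by blast
    qed
  qed
qed

section \<open>Generalized Krull domains\<close>

lemma (in domain) nonzero_submonoid: "submonoid (carrier R - {\<zero>}) R"
  by unfold_locales (auto simp: integral_iff)

lemma (in domain) Frac_frac_eq_iff:
  assumes "a \<in> carrier R" "b \<in> carrier R" "s \<in> carrier R - {\<zero>}" "t \<in> carrier R - {\<zero>}"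
  shows "loc_frac R (carrier R - {\<zero>}) a s = loc_frac R (carrier R - {\<zero>}) b t
    \<longleftrightarrow> a \<otimes> t = b \<otimes> s"
proof -
  have "(\<exists>u\<in>carrier R - {\<zero>}. u \<otimes> (a \<otimes> t) = u \<otimes> (b \<otimes> s)) \<longleftrightarrow> a \<otimes> t = b \<otimes> s"
  proof
    assume "\<exists>u\<in>carrier R - {\<zero>}. u \<otimes> (a \<otimes> t) = u \<otimes> (b \<otimes> s)"
    then show "a \<otimes> t = b \<otimes> s" using assms m_lcancel by auto
  next
    assume "a \<otimes> t = b \<otimes> s"
    then show "\<exists>u\<in>carrier R - {\<zero>}. u \<otimes> (a \<otimes> t) = u \<otimes> (b \<otimes> s)"
      by (intro bexI[of _ \<one>]) auto
  qed
  then show ?thesis using loc_frac_eq_iff[OF nonzero_submonoid assms] by simp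
qed

lemma Spec1_Spec: "q \<in> Spec1 R \<Longrightarrow> q \<in> Spec R"
  by (simp add: Spec1_def)

lemma (in domain) zero_Spec: "{\<zero>} \<in> Spec R"
  unfolding Spec_iff using integral by auto

text \<open>Condition (1) of a generalized Krull domain in terms of divisibility: the fraction
  \<open>a/b\<close> lies in the localization at \<open>q\<close> as soon as \<open>b\<close>
  divides \<open>a \<otimes> d\<close> for some \<open>d\<close> outside \<open>q\<close>. In this
  form localizations are handled through elements of \<open>R\<close> alone.\<close>

lemma (in domain) gkd_divides:
  assumes S: "generalized_Krull_domain R"
    and ab: "a \<in> carrier R" "b \<in> carrier R" "b \<noteq> \<zero>"
    and loc: "\<And>q. q \<in> Spec1 R \<Longrightarrow> \<exists>d\<in>carrier R - q. b divides a \<otimes> d"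
  shows "b divides a"
proof -
  let ?f = "loc_frac R (carrier R - {\<zero>})"
  have "?f a b \<in> carrier (Frac R)"
    using ab by (auto simp: Frac_def localization_def fractions_def)
  moreover have "?f a b \<in> loc_at R q" if q: "q \<in> Spec1 R" for q
  proof -
    obtain d c where d: "d \<in> carrier R" "d \<notin> q" and c: "c \<in> carrier R" "a \<otimes> d = b \<otimes> c"
      using loc[OF q] by (auto elim!: dividesE)
    have "\<zero> \<in> q" using Spec1_Spec[OF q] by (simp add: Spec_iff)
    then have "d \<noteq> \<zero>" using d by auto
    then have "?f a b = ?f c d"
      using ab c d by (simp add: Frac_frac_eq_iff m_comm)
    then show ?thesis using c d by (auto simp: loc_at_def fractions_def)
  qed
  ultimately have "?f a b \<in> in_Frac R"
    using S unfolding generalized_Krull_domain_def by blast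
  then obtain c where c: "c \<in> carrier R" "?f a b = ?f c \<one>"
    by (auto simp: in_Frac_def fractions_def)
  then have "a = b \<otimes> c" using ab by (simp add: Frac_frac_eq_iff m_comm)
  then show ?thesis using c by (auto intro: dividesI)
qed

text \<open>Condition (3) in the same form: \<open>a\<close> and \<open>b\<close> are compared in
  the valuation ring at \<open>q\<close>, and \<open>d\<close> is the denominator of the
  quotient.\<close>

lemma (in domain) gkd_valuation:
  assumes S: "generalized_Krull_domain R" and q: "q \<in> Spec1 R"
    and ab: "a \<in> carrier R" "b \<in> carrier R"
  shows "\<exists>d\<in>carrier R - q. a divides b \<otimes> d \<or> b divides a \<otimes> d"
proof -
  let ?f = "loc_frac R (carrier R - {\<zero>})"
  let ?V = "(Frac R)\<lparr>carrier := loc_at R q\<rparr>"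
  have q': "\<zero> \<in> q" "\<one> \<notin> q" using Spec1_Spec[OF q] by (simp_all add: Spec_iff)
  have *: "\<exists>d\<in>carrier R - q. a divides b \<otimes> d"
    if "a \<in> carrier R" "b \<in> carrier R" and dv: "?f a \<one> divides\<^bsub>?V\<^esub> ?f b \<one>" for a b
  proof -
    from dv obtain z where "z \<in> loc_at R q" "?f b \<one> = ?f a \<one> \<otimes>\<^bsub>Frac R\<^esub> z"
      by (auto elim!: dividesE)
    then obtain c d where cd: "c \<in> carrier R" "d \<in> carrier R" "d \<notin> q"
      and e: "?f b \<one> = ?f a \<one> \<otimes>\<^bsub>Frac R\<^esub> ?f c d"
      by (auto simp: loc_at_def fractions_def)
    have d0: "d \<noteq> \<zero>" using cd q' by auto
    have "?f b \<one> = ?f (a \<otimes> c) (\<one> \<otimes> d)"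
      unfolding e Frac_def using that cd d0 by (intro loc_frac_mult[OF nonzero_submonoid]) auto
    then have "b \<otimes> d = a \<otimes> c" using that cd d0 by (simp add: Frac_frac_eq_iff)
    then show ?thesis using cd by (auto intro: dividesI)
  qed
  have "?f x \<one> \<in> carrier ?V" if "x \<in> carrier R" for x
    using that q' by (auto simp: loc_at_def fractions_def)
  then have "?f a \<one> divides\<^bsub>?V\<^esub> ?f b \<one> \<or> ?f b \<one> divides\<^bsub>?V\<^esub> ?f a \<one>"
    using S q ab unfolding generalized_Krull_domain_def valuation_domain_def by blast
  then show ?thesis using *[OF ab] *[OF ab(2,1)] by blast
qed

text \<open>If \<open>b\<close> divided no \<open>s\<^sup>n d\<close> with \<open>d\<close> outside \<open>q\<close>, the elements with that property would form a prime strictly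
  between \<open>0\<close> and \<open>q\<close>.\<close>

lemma (in domain) gkd_archimedean:
  assumes S: "generalized_Krull_domain R" and q: "q \<in> Spec1 R"
    and s: "s \<in> q" and b: "b \<in> carrier R" "b \<noteq> \<zero>"
  shows "\<exists>n::nat. \<exists>d\<in>carrier R - q. b divides s [^] n \<otimes> d"
proof (rule ccontr)
  assume no: "\<not> ?thesis"
  \<comment> \<open>\<open>D x\<close> says that \<open>x\<close> becomes a unit once
    \<open>s\<close> and everything outside \<open>q\<close> are inverted. \<open>P\<close> collects
    the remaining elements, \<open>b\<close> among them.\<close>
  define D where "D x \<longleftrightarrow> (\<exists>n::nat. \<exists>d\<in>carrier R - q. x divides s [^] n \<otimes> d)" for x
  define P where "P = {x \<in> carrier R. \<not> D x}"
  have qS: "q \<in> Spec R" by (rule Spec1_Spec[OF q])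
  note q' = qS[unfolded Spec_iff]
  have sc: "s \<in> carrier R" using q' s by auto
  have pr: "d \<otimes> e \<in> carrier R - q" if "d \<in> carrier R - q" "e \<in> carrier R - q" for d e
    using that q' by auto
  have D_div: "D x" if Dy: "D y" and xy: "x divides y" and x: "x \<in> carrier R" for x y
  proof -
    obtain n d where "d \<in> carrier R - q" "y divides s [^] (n::nat) \<otimes> d"
      using Dy unfolding D_def by blast
    then show ?thesis
      using divides_trans[OF xy _ x] unfolding D_def by blast
  qed
  have D_mult: "D (x \<otimes> y)" if xy: "x \<in> carrier R" "y \<in> carrier R" and Dx: "D x" and Dy: "D y" for x y
  proof -
    obtain n d where n: "d \<in> carrier R - q" "x divides s [^] (n::nat) \<otimes> d"
      using Dx unfolding D_def by blast
    obtain m e where m: "e \<in> carrier R - q" "y divides s [^] (m::nat) \<otimes> e"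
      using Dy unfolding D_def by blast
    obtain u where u: "u \<in> carrier R" "s [^] n \<otimes> d = x \<otimes> u" using n(2) by (auto elim: dividesE)
    obtain v where v: "v \<in> carrier R" "s [^] m \<otimes> e = y \<otimes> v" using m(2) by (auto elim: dividesE)
    have "s [^] (n + m) \<otimes> (d \<otimes> e) = (s [^] n \<otimes> d) \<otimes> (s [^] m \<otimes> e)"
      using n(1) m(1) sc by (simp add: nat_pow_mult[symmetric] m_ac)
    also have "\<dots> = (x \<otimes> y) \<otimes> (u \<otimes> v)" unfolding u(2) v(2) using u(1) v(1) xy by (simp add: m_ac)
    finally have "x \<otimes> y divides s [^] (n + m) \<otimes> (d \<otimes> e)"
      using u(1) v(1) by (intro dividesI[of "u \<otimes> v"]) auto
    then show ?thesis unfolding D_def using pr[OF n(1) m(1)] by auto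
  qed
  have D_notin: "D x" if "x \<in> carrier R - q" for x
  proof -
    have "x divides s [^] (0::nat) \<otimes> x" using that by simp
    then show ?thesis unfolding D_def using that by blast
  qed
  \<comment> \<open>This is what closure of \<open>P\<close> under addition rests on: of two
    elements of \<open>P\<close>, one divides the other up to a factor \<open>e\<close> outside
    \<open>q\<close>, hence divides \<open>e\<close> times their sum, and \<open>D\<close> passes
    from a multiple to its divisors.\<close>
  have D_cancel: "D x" if "x \<in> carrier R" "y \<in> carrier R" "e \<in> carrier R - q" "D (x \<oplus> y)" and dv: "x divides y \<otimes> e" for x y e
  proof -
    have "D (e \<otimes> (x \<oplus> y))" using D_mult[of e "x \<oplus> y"] D_notin[of e] that by auto
    moreover have "x divides e \<otimes> (x \<oplus> y)"
    proof -
      obtain u where u: "u \<in> carrier R" "y \<otimes> e = x \<otimes> u" using dv by (auto elim: dividesE)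
      have "e \<otimes> (x \<oplus> y) = x \<otimes> e \<oplus> y \<otimes> e" using that by (simp add: r_distr m_comm)
      also have "\<dots> = x \<otimes> (e \<oplus> u)" unfolding u(2) using that u by (simp add: r_distr)
      finally show ?thesis using that u by (intro dividesI[of "e \<oplus> u"]) auto
    qed
    ultimately show ?thesis using D_div that(1) by simp
  qed
  have PS: "P \<in> Spec R"
    unfolding Spec_iff
  proof (intro conjI ballI impI)
    show "P \<subseteq> carrier R" by (auto simp: P_def)
    show "\<one> \<notin> P" using D_notin[of \<one>] q' by (auto simp: P_def)
    show zP: "\<zero> \<in> P"
    proof (rule ccontr)
      assume "\<zero> \<notin> P"
      then have "D \<zero>" by (simp add: P_def)
      moreover have "b divides \<zero>" using b by (intro dividesI[of \<zero>]) simp_all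
      ultimately have "D b" by (rule D_div) (rule b(1))
      then show False using no unfolding D_def by blast
    qed
    fix x assume x: "x \<in> P"
    then have xc: "x \<in> carrier R" and Dx: "\<not> D x" by (auto simp: P_def)
    {
      fix y assume y: "y \<in> P"
      then have yc: "y \<in> carrier R" and Dy: "\<not> D y" by (auto simp: P_def)
      have "\<not> D (x \<oplus> y)"
      proof
        assume D: "D (x \<oplus> y)"
        obtain e where e: "e \<in> carrier R - q" and "x divides y \<otimes> e \<or> y divides x \<otimes> e"
          using gkd_valuation[OF S q xc yc] by (elim bexE)
        then show False
          using D_cancel[OF xc yc e D] D_cancel[OF yc xc e] D Dx Dy a_comm[OF xc yc] by auto
      qed
      then show "x \<oplus> y \<in> P" using xc yc by (auto simp: P_def)
    next
      fix a assume a: "a \<in> carrier R"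
      then have "x divides a \<otimes> x" using xc by (intro dividesI[of a]) (auto simp: m_comm)
      then show "a \<otimes> x \<in> P" using D_div[of "a \<otimes> x" x] a xc Dx by (auto simp: P_def)
    }
  next
    fix x y assume "x \<in> carrier R" "y \<in> carrier R" "x \<otimes> y \<in> P"
    then show "x \<in> P \<or> y \<in> P" using D_mult[of x y] by (auto simp: P_def)
  qed
  have "D s"
  proof -
    have "s divides s [^] (1::nat) \<otimes> \<one>" using sc by simp
    moreover have "\<one> \<in> carrier R - q" using q' by simp
    ultimately show ?thesis unfolding D_def by blast
  qed
  then have sP: "s \<notin> P" by (simp add: P_def)
  \<comment> \<open>\<open>s\<close> satisfies \<open>D\<close> and so separates \<open>P\<close>
    from \<open>q\<close>, while \<open>b\<close> separates \<open>P\<close> from zero. The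
    resulting chain of three primes contradicts height one.\<close>
  have Pq: "P \<subset> q" using s sP D_notin by (auto simp: P_def)
  have bP: "b \<in> P" using no b by (auto simp: P_def D_def)
  have zP: "{\<zero>} \<subset> P" using PS[unfolded Spec_iff] b bP by auto
  have "enat 2 \<le> prime_height R q"
    unfolding prime_height_def
  proof (rule Sup_upper, simp, intro exI[of _ "\<lambda>i::nat. if i = 0 then {\<zero>} else if i = 1 then P else q"] conjI allI impI)
    fix i :: nat
    show "i \<le> 2 \<Longrightarrow> (if i = 0 then {\<zero>} else if i = 1 then P else q) \<in> Spec R"
      using zero_Spec PS qS by auto
    show "i < 2 \<Longrightarrow> (if i = 0 then {\<zero>} else if i = 1 then P else q) \<subset>
        (if Suc i = 0 then {\<zero>} else if Suc i = 1 then P else q)"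
      using zP Pq by (cases "i = 0") auto
  qed simp
  moreover have "prime_height R q = 1" using q by (simp add: Spec1_def)
  ultimately show False by (simp add: one_enat_def)
qed

text \<open>The localization at \<open>M\<close> is the intersection of the localizations at the
  height one primes disjoint from \<open>M\<close>. Only finitely many other height one primes
  contain \<open>b\<close>, and at each of them a power of an element of \<open>M\<close> absorbs
  \<open>b\<close>, by \<open>gkd_archimedean\<close>; the product of these powers is the
  denominator \<open>t\<close>.\<close>

lemma (in domain) gkd_localization:
  assumes S: "generalized_Krull_domain R" and M: "submonoid M R"
    and ab: "a \<in> carrier R" "b \<in> carrier R" "b \<noteq> \<zero>"
    and loc: "\<And>q. q \<in> Spec1 R \<Longrightarrow> q \<inter> M = {} \<Longrightarrow> \<exists>d\<in>carrier R - q. b divides a \<otimes> d"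
  shows "\<exists>t\<in>M. b divides a \<otimes> t"
proof -
  interpret M: submonoid M R by (rule M)
  have Mc: "x \<in> carrier R" if "x \<in> M" for x using M.subset that by blast
  define F where "F = {q \<in> Spec1 R. b \<in> q \<and> q \<inter> M \<noteq> {}}"
  have "finite {q \<in> Spec1 R. b \<in> q}" using S ab unfolding generalized_Krull_domain_def by blast
  then have finF: "finite F" by (rule rev_finite_subset) (auto simp: F_def)
  \<comment> \<open>Induction over the exceptional primes: a new \<open>q\<close> contributes a
    power of some \<open>s \<in> q \<inter> M\<close>, and the extra factor preserves divisibility
    at the primes already treated.\<close>
  have "\<exists>t\<in>M. \<forall>q\<in>G. \<exists>d\<in>carrier R - q. b divides a \<otimes> t \<otimes> d" if "G \<subseteq> F" for G
    using finite_subset[OF that finF] that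
  proof (induction G rule: finite_induct)
    case empty
    show ?case using M.one_closed by blast
  next
    case (insert q G)
    then obtain t where t: "t \<in> M" "\<And>q. q \<in> G \<Longrightarrow> \<exists>d\<in>carrier R - q. b divides a \<otimes> t \<otimes> d" by blast
    have q: "q \<in> Spec1 R" "q \<inter> M \<noteq> {}" using insert by (auto simp: F_def)
    then obtain s where s: "s \<in> q" "s \<in> M" by blast
    obtain n d where d: "d \<in> carrier R - q" "b divides s [^] (n::nat) \<otimes> d"
      using gkd_archimedean[OF S q(1) s(1) ab(2,3)] by blast
    have sn: "s [^] n \<in> M" by (induction n) (auto simp: s)
    show ?case
    proof (rule bexI[of _ "t \<otimes> s [^] n"], rule ballI)
      show "t \<otimes> s [^] n \<in> M" using t(1) sn by simp
      fix q' assume "q' \<in> insert q G"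
      then consider "q' = q" | "q' \<in> G" by blast
      then show "\<exists>d\<in>carrier R - q'. b divides a \<otimes> (t \<otimes> s [^] n) \<otimes> d"
      proof cases
        case 1
        have "a \<otimes> (t \<otimes> s [^] n) \<otimes> d = (s [^] n \<otimes> d) \<otimes> (a \<otimes> t)"
          using ab Mc[OF t(1)] Mc[OF sn] d(1) by (simp add: m_ac)
        moreover have "b divides (s [^] n \<otimes> d) \<otimes> (a \<otimes> t)"
          by (rule divides_prod_r) (use ab Mc[OF t(1)] Mc[OF sn] d in auto)
        ultimately show ?thesis using d(1) 1 by (intro bexI[of _ d]) auto
      next
        case 2
        then obtain e where e: "e \<in> carrier R - q'" "b divides a \<otimes> t \<otimes> e" using t(2) by blast
        have "a \<otimes> (t \<otimes> s [^] n) \<otimes> e = (a \<otimes> t \<otimes> e) \<otimes> s [^] n"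
          using ab Mc[OF t(1)] Mc[OF sn] e(1) by (simp add: m_ac)
        moreover have "b divides (a \<otimes> t \<otimes> e) \<otimes> s [^] n"
          by (rule divides_prod_r) (use ab Mc[OF t(1)] Mc[OF sn] e in auto)
        ultimately show ?thesis using e(1) by (intro bexI[of _ e]) auto
      qed
    qed
  qed
  from this[OF subset_refl] obtain t
    where t: "t \<in> M" and tF: "\<forall>q\<in>F. \<exists>d\<in>carrier R - q. b divides a \<otimes> t \<otimes> d"
    by (elim bexE)
  have "b divides a \<otimes> t"
  proof (rule gkd_divides[OF S _ ab(2,3)])
    show "a \<otimes> t \<in> carrier R" using ab Mc[OF t] by simp
    fix q assume q: "q \<in> Spec1 R"
    \<comment> \<open>On \<open>F\<close> the constructed \<open>t\<close> works; where
      \<open>b\<close> is outside \<open>q\<close>, \<open>b\<close> itself serves as the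
      multiplier; where \<open>q\<close> misses \<open>M\<close>, the hypothesis applies.\<close>
    consider "q \<in> F" | "b \<notin> q" | "q \<inter> M = {}" using q by (auto simp: F_def)
    then show "\<exists>d\<in>carrier R - q. b divides a \<otimes> t \<otimes> d"
    proof cases
      case 1 then show ?thesis by (rule bspec[OF tF])
    next
      case 2
      have "b divides a \<otimes> t \<otimes> b" using ab Mc[OF t] by (intro dividesI[of "a \<otimes> t"]) (auto simp: m_ac)
      then show ?thesis using 2 ab by blast
    next
      case 3
      then obtain d where d: "d \<in> carrier R - q" "b divides a \<otimes> d" using loc[OF q] by blast
      have "a \<otimes> t \<otimes> d = (a \<otimes> d) \<otimes> t" using ab Mc[OF t] d(1) by (simp add: m_ac)
      moreover have "b divides (a \<otimes> d) \<otimes> t"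
        by (rule divides_prod_r) (use ab Mc[OF t] d in auto)
      ultimately show ?thesis using d(1) by (intro bexI[of _ d]) auto
    qed
  qed
  then show ?thesis using t by blast
qed

section \<open>Overrings satisfying going-down\<close>

text \<open>\<open>K\<close> plays the fraction field of \<open>R\<close>. As fractions over
  \<open>R\<close> are classes of pairs, \<open>S\<close> is not literally inside \<open>K\<close>
  but embedded by \<open>\<sigma>\<close>. \<open>J\<close> is a common ideal of \<open>R\<close>
  and \<open>S\<close>, and \<open>height\<close> is the form in which height at least two
  enters.\<close>

locale going_down_overring = S: domain S + K: domain K
  for S (structure) and K (structure) +
  fixes \<sigma> R J L
  assumes gkd: "generalized_Krull_domain S"
    and hom: "\<sigma> \<in> ring_hom S K" and inj: "inj_on \<sigma> (carrier S)"
    and R: "subring R S" and J: "ideal J S" and JR: "J \<subseteq> R"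
    and height: "\<And>q. q \<in> Spec1 S \<Longrightarrow> \<not> J \<subseteq> q"
    and frac: "\<And>x. x \<in> carrier K \<Longrightarrow> \<exists>a\<in>R. \<exists>b\<in>R - {\<zero>}. x \<otimes>\<^bsub>K\<^esub> \<sigma> b = \<sigma> a"
    and L: "subring L K" and RL: "\<sigma> ` R \<subseteq> L"
    and gd: "going_down (\<sigma> ` R) (K\<lparr>carrier := L\<rparr>)"
begin

section \<open>Arithmetic of the embedding of \<open>S\<close> and of the common ideal
  \<open>J\<close>\<close>

lemma R_carrier [simp]: "r \<in> R \<Longrightarrow> r \<in> carrier S"
  using subringE(1)[OF R] by auto

lemma L_carrier [simp]: "x \<in> L \<Longrightarrow> x \<in> carrier K"
  using subringE(1)[OF L] by auto

lemma sigma_L [simp]: "r \<in> R \<Longrightarrow> \<sigma> r \<in> L"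
  using RL by auto

lemma sigma_simps [simp]:
  "s \<in> carrier S \<Longrightarrow> \<sigma> s \<in> carrier K"
  "s \<in> carrier S \<Longrightarrow> t \<in> carrier S \<Longrightarrow> \<sigma> (s \<otimes> t) = \<sigma> s \<otimes>\<^bsub>K\<^esub> \<sigma> t"
  "s \<in> carrier S \<Longrightarrow> t \<in> carrier S \<Longrightarrow> \<sigma> (s \<oplus> t) = \<sigma> s \<oplus>\<^bsub>K\<^esub> \<sigma> t"
  "\<sigma> \<one> = \<one>\<^bsub>K\<^esub>"
  "\<sigma> \<zero> = \<zero>\<^bsub>K\<^esub>"
  using ring_hom_closed[OF hom] ring_hom_mult[OF hom] ring_hom_add[OF hom] ring_hom_one[OF hom]
    ring_hom_zero[OF hom S.ring_axioms K.ring_axioms] by simp_all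

lemma sigma_eq_iff [simp]:
  "s \<in> carrier S \<Longrightarrow> t \<in> carrier S \<Longrightarrow> \<sigma> s = \<sigma> t \<longleftrightarrow> s = t"
  using inj by (auto dest: inj_onD)

lemma sigma_eq_zero_iff [simp]: "s \<in> carrier S \<Longrightarrow> \<sigma> s = \<zero>\<^bsub>K\<^esub> \<longleftrightarrow> s = \<zero>"
  using sigma_eq_iff[of s \<zero>] by simp

lemma J_mult: "j \<in> J \<Longrightarrow> s \<in> carrier S \<Longrightarrow> j \<otimes> s \<in> J" "j \<in> J \<Longrightarrow> s \<in> carrier S \<Longrightarrow> s \<otimes> j \<in> J"
  using ideal.I_r_closed[OF J] ideal.I_l_closed[OF J] by auto

lemma J_carrier: "j \<in> J \<Longrightarrow> j \<in> carrier S"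
  using JR by auto

text \<open>Going-down is assumed for the image of \<open>R\<close> in \<open>K\<close>.
  Transporting \<open>q \<inter> R\<close> along the injective \<open>\<sigma>\<close> makes it
  usable for primes \<open>q\<close> of \<open>S\<close>, with elementwise conditions in place of
  images.\<close>

lemma going_down_prime:
  assumes q: "q \<in> Spec S" and Q: "Q \<in> Spec (K\<lparr>carrier := L\<rparr>)"
    and le: "\<And>r. r \<in> q \<inter> R \<Longrightarrow> \<sigma> r \<in> Q"
  obtains Q1 where "Q1 \<in> Spec (K\<lparr>carrier := L\<rparr>)" "Q1 \<subseteq> Q" "\<And>r. r \<in> R \<Longrightarrow> \<sigma> r \<in> Q1 \<longleftrightarrow> r \<in> q"
proof -
  note q' = q[unfolded S.Spec_iff]
  have sR: "subring (\<sigma> ` R) K"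
    by (rule ring_hom_ring.img_is_subring[OF ring_hom_ringI2[OF S.ring_axioms K.ring_axioms hom] R])
  have mem: "\<sigma> r \<in> \<sigma> ` (q \<inter> R) \<longleftrightarrow> r \<in> q" if "r \<in> R" for r
    using that by auto
  have "\<sigma> ` (q \<inter> R) \<in> Spec (K\<lparr>carrier := \<sigma> ` R\<rparr>)"
    unfolding K.Spec_subring_iff[OF sR]
  proof (intro conjI ballI impI)
    show "\<sigma> ` (q \<inter> R) \<subseteq> \<sigma> ` R" by blast
    show "\<zero>\<^bsub>K\<^esub> \<in> \<sigma> ` (q \<inter> R)" using mem[of \<zero>] q' subringE(2)[OF R] by simp
    show "\<one>\<^bsub>K\<^esub> \<notin> \<sigma> ` (q \<inter> R)" using mem[of \<one>] q' subringE(3)[OF R] by simp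
    fix x assume "x \<in> \<sigma> ` (q \<inter> R)"
    then obtain r where r: "x = \<sigma> r" "r \<in> q" "r \<in> R" by blast
    {
      fix y assume "y \<in> \<sigma> ` (q \<inter> R)"
      then obtain s where s: "y = \<sigma> s" "s \<in> q" "s \<in> R" by blast
      show "x \<oplus>\<^bsub>K\<^esub> y \<in> \<sigma> ` (q \<inter> R)"
        using mem[of "r \<oplus> s"] r s q' subringE(7)[OF R r(3) s(3)] by simp
    next
      fix y assume "y \<in> \<sigma> ` R"
      then obtain s where s: "y = \<sigma> s" "s \<in> R" by blast
      show "y \<otimes>\<^bsub>K\<^esub> x \<in> \<sigma> ` (q \<inter> R)"
        using mem[of "s \<otimes> r"] r s q' subringE(6)[OF R s(2) r(3)] by simp
    }
  next
    fix x y assume "x \<in> \<sigma> ` R" "y \<in> \<sigma> ` R" and xy: "x \<otimes>\<^bsub>K\<^esub> y \<in> \<sigma> ` (q \<inter> R)"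
    then obtain r s where rs: "x = \<sigma> r" "r \<in> R" "y = \<sigma> s" "s \<in> R" by blast
    then have "r \<otimes> s \<in> q" using xy mem[of "r \<otimes> s"] subringE(6)[OF R rs(2,4)] by simp
    then have "r \<in> q \<or> s \<in> q" using q' rs by simp
    then show "x \<in> \<sigma> ` (q \<inter> R) \<or> y \<in> \<sigma> ` (q \<inter> R)" using rs by blast
  qed
  moreover have "Q \<inter> \<sigma> ` R \<in> Spec (K\<lparr>carrier := \<sigma> ` R\<rparr>)"
    by (rule K.Spec_contract[OF sR L RL Q])
  moreover have "\<sigma> ` (q \<inter> R) \<subseteq> Q \<inter> \<sigma> ` R" using le by blast
  moreover have "\<exists>Q1\<in>Spec (K\<lparr>carrier := L\<rparr>). Q1 \<subseteq> Q \<and> Q1 \<inter> \<sigma> ` R = p"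
    if "p \<in> Spec (K\<lparr>carrier := \<sigma> ` R\<rparr>)" "Q \<inter> \<sigma> ` R \<in> Spec (K\<lparr>carrier := \<sigma> ` R\<rparr>)"
      "p \<subseteq> Q \<inter> \<sigma> ` R" for p
    using gd[unfolded going_down_def, rule_format, of p "Q \<inter> \<sigma> ` R" Q] that Q by simp
  ultimately obtain Q1 where Q1: "Q1 \<in> Spec (K\<lparr>carrier := L\<rparr>)" "Q1 \<subseteq> Q" "Q1 \<inter> \<sigma> ` R = \<sigma> ` (q \<inter> R)"
    by metis
  have "\<sigma> r \<in> Q1 \<longleftrightarrow> r \<in> q" if "r \<in> R" for r
    using mem[OF that] Q1(3) that by blast
  then show ?thesis using that Q1 by blast
qed

text \<open>A prime \<open>Q\<close> of \<open>L\<close> over \<open>q \<inter> R\<close> forces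
  \<open>x = a/b\<close> into the valuation ring of \<open>S\<close> at \<open>q\<close>. Otherwise
  \<open>x\<close> would be \<open>d/c\<close> with \<open>c\<close> in \<open>q\<close> and
  \<open>d\<close> outside, and the equation \<open>x c = d\<close> would push a multiple of
  \<open>d\<close> into \<open>Q\<close>.\<close>

lemma divides_at_height_one:
  assumes x: "x \<in> L" and ab: "a \<in> R" "b \<in> R" "b \<noteq> \<zero>" and e: "x \<otimes>\<^bsub>K\<^esub> \<sigma> b = \<sigma> a"
    and q: "q \<in> Spec1 S" and Q: "Q \<in> Spec (K\<lparr>carrier := L\<rparr>)"
    and Qq: "\<And>r. r \<in> R \<Longrightarrow> \<sigma> r \<in> Q \<longleftrightarrow> r \<in> q"
  shows "\<exists>d\<in>carrier S - q. b divides a \<otimes> d"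
proof -
  note q' = Spec1_Spec[OF q, unfolded S.Spec_iff]
  obtain d where d: "d \<in> carrier S - q" "b divides a \<otimes> d \<or> a divides b \<otimes> d"
    using S.gkd_valuation[OF gkd q R_carrier[OF ab(2)] R_carrier[OF ab(1)]] by (elim bexE)
  show ?thesis
  proof (cases "b divides a \<otimes> d")
    case True
    then show ?thesis using d(1) by blast
  next
    case False
    then have "a divides b \<otimes> d" using d(2) by simp
    then obtain c where c: "c \<in> carrier S" "b \<otimes> d = a \<otimes> c" by (auto elim: dividesE)
    show ?thesis
    proof (cases "c \<in> q")
      case False
      have "b divides a \<otimes> c" using d(1) ab by (intro dividesI[of d]) (auto simp: c(2))
      then show ?thesis using False c(1) by blast
    next
      case True
      have "\<sigma> b \<otimes>\<^bsub>K\<^esub> (x \<otimes>\<^bsub>K\<^esub> \<sigma> c) = (x \<otimes>\<^bsub>K\<^esub> \<sigma> b) \<otimes>\<^bsub>K\<^esub> \<sigma> c"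
        using x ab c(1) by (simp add: K.m_ac)
      also have "\<dots> = \<sigma> (b \<otimes> d)" unfolding e c(2) using ab c(1) by simp
      also have "\<dots> = \<sigma> b \<otimes>\<^bsub>K\<^esub> \<sigma> d" using ab d(1) by simp
      finally have xc: "x \<otimes>\<^bsub>K\<^esub> \<sigma> c = \<sigma> d"
        using x ab c(1) d(1) by (subst (asm) K.m_lcancel) auto
      \<comment> \<open>\<open>c\<close> and \<open>d\<close> may lie outside \<open>R\<close>, but
        their multiples by \<open>j \<in> J\<close> do not. Since \<open>j \<notin> q\<close>,
        primality of \<open>q\<close> removes \<open>j\<close> again.\<close>
      obtain j where j: "j \<in> J" "j \<notin> q" using height[OF q] by blast
      have jR: "j \<otimes> c \<in> R" "j \<otimes> d \<in> R" using J_mult(1)[OF j(1)] c(1) d(1) JR by auto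
      have jS: "j \<in> carrier S" by (rule J_carrier[OF j(1)])
      have "j \<otimes> c \<in> q" using True jS q' by simp
      then have "\<sigma> (j \<otimes> c) \<in> Q" using Qq[OF jR(1)] by simp
      then have "x \<otimes>\<^bsub>K\<^esub> \<sigma> (j \<otimes> c) \<in> Q" using Q[unfolded K.Spec_subring_iff[OF L]] x by simp
      moreover have "x \<otimes>\<^bsub>K\<^esub> \<sigma> (j \<otimes> c) = \<sigma> j \<otimes>\<^bsub>K\<^esub> (x \<otimes>\<^bsub>K\<^esub> \<sigma> c)"
        using x jS c(1) by (simp add: K.m_ac)
      ultimately have "\<sigma> (j \<otimes> d) \<in> Q" using jS d(1) by (simp add: xc)
      then have "j \<otimes> d \<in> q" using Qq[OF jR(2)] by simp
      then show ?thesis using q' jS j(2) d(1) by auto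
    qed
  qed
qed

text \<open>If a height one prime \<open>q\<close> of \<open>S\<close> contains no
  \<open>t \<in> R\<close> with \<open>\<sigma> t\<close> outside \<open>Q\<close>, then
  \<open>q \<inter> R\<close> maps into \<open>Q\<close>, so going-down provides a prime of
  \<open>L\<close> over \<open>q \<inter> R\<close> and \<open>x\<close> lies in the localization at
  \<open>q\<close>. \<open>gkd_localization\<close> assembles these local statements into one
  denominator.\<close>

lemma overring_denominator:
  assumes Q: "Q \<in> Spec (K\<lparr>carrier := L\<rparr>)" and x: "x \<in> L"
  shows "\<exists>c\<in>carrier S. \<exists>t\<in>R. \<sigma> t \<notin> Q \<and> x \<otimes>\<^bsub>K\<^esub> \<sigma> t = \<sigma> c"
proof -
  note Q' = Q[unfolded K.Spec_subring_iff[OF L]]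
  let ?M = "{t \<in> R. \<sigma> t \<notin> Q}"
  obtain a b where ab: "a \<in> R" "b \<in> R" "b \<noteq> \<zero>" and e: "x \<otimes>\<^bsub>K\<^esub> \<sigma> b = \<sigma> a"
    using frac[of x] x by auto
  have M: "submonoid ?M S"
    by (rule submonoid.intro)
      (use K.Spec_subring_mult_iff[OF L Q] Q' subringE(3,6)[OF R] in auto)
  have "\<exists>t\<in>?M. b divides a \<otimes> t"
  proof (rule S.gkd_localization[OF gkd M])
    fix q assume q: "q \<in> Spec1 S" "q \<inter> ?M = {}"
    then have "\<And>r. r \<in> q \<inter> R \<Longrightarrow> \<sigma> r \<in> Q" by blast
    from going_down_prime[OF Spec1_Spec[OF q(1)] Q this] obtain Q1
      where "Q1 \<in> Spec (K\<lparr>carrier := L\<rparr>)" "\<And>r. r \<in> R \<Longrightarrow> \<sigma> r \<in> Q1 \<longleftrightarrow> r \<in> q" by metis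
    then show "\<exists>d\<in>carrier S - q. b divides a \<otimes> d"
      by (rule divides_at_height_one[OF x ab e q(1)])
  qed (use ab in auto)
  then obtain t c where t: "t \<in> R" "\<sigma> t \<notin> Q" and c: "c \<in> carrier S" "a \<otimes> t = b \<otimes> c"
    by (auto elim!: dividesE)
  have "\<sigma> b \<otimes>\<^bsub>K\<^esub> (x \<otimes>\<^bsub>K\<^esub> \<sigma> t) = (x \<otimes>\<^bsub>K\<^esub> \<sigma> b) \<otimes>\<^bsub>K\<^esub> \<sigma> t"
    using x ab t(1) by (simp add: K.m_ac)
  also have "\<dots> = \<sigma> (a \<otimes> t)" unfolding e using ab t(1) by simp
  also have "\<dots> = \<sigma> b \<otimes>\<^bsub>K\<^esub> \<sigma> c" unfolding c(2) using ab c(1) by simp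
  finally have "x \<otimes>\<^bsub>K\<^esub> \<sigma> t = \<sigma> c"
    using x ab c(1) t(1) by (subst (asm) K.m_lcancel) auto
  then show ?thesis using t c(1) by blast
qed

text \<open>A height one prime \<open>q\<close> of \<open>S\<close> carries \<open>c\<close> from
  \<open>P\<close> to \<open>Q\<close>: integrality yields \<open>q\<close> containing
  \<open>c\<close> with \<open>q \<inter> R\<close> inside \<open>P\<close>, hence inside
  \<open>Q\<close>, and going-down below \<open>Q\<close> does the rest. The integral equations hold
  modulo \<open>J\<close>, which suffices because \<open>J \<subseteq> R\<close>.\<close>

lemma contraction_determines_numerators:
  assumes P: "P \<in> Spec (K\<lparr>carrier := L\<rparr>)" and Q: "Q \<in> Spec (K\<lparr>carrier := L\<rparr>)"
    and PQ: "P \<inter> \<sigma> ` R = Q \<inter> \<sigma> ` R"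
    and integral: "\<And>y. y \<in> carrier S \<Longrightarrow> \<exists>(n::nat) f. (\<forall>i<n. f i \<in> R) \<and>
      y [^] n \<oplus> (\<Oplus>i\<in>{..<n}. f i \<otimes> y [^] i) \<in> J"
    and c: "c \<in> carrier S" "\<sigma> c \<in> P"
  shows "\<sigma> c \<in> Q"
proof (cases "c = \<zero>")
  case True
  then show ?thesis using Q[unfolded K.Spec_subring_iff[OF L]] by simp
next
  case False
  note P' = P[unfolded K.Spec_subring_iff[OF L]] and Q' = Q[unfolded K.Spec_subring_iff[OF L]]
  have cL: "\<sigma> c \<in> L" using c P' by auto
  let ?M = "{t \<in> carrier S. \<sigma> t \<in> L \<and> \<sigma> t \<notin> P}"
  have M: "submonoid ?M S"
    by (rule submonoid.intro)
      (use K.Spec_subring_mult_iff[OF L P] P' subringE(3,6)[OF L] in auto)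
  \<comment> \<open>Without such a \<open>q\<close>, the multiplier \<open>d = c\<close> works at
    every height one prime missing \<open>?M\<close>, so \<open>c\<close> divides an element
    \<open>t\<close> of \<open>?M\<close>: it becomes a unit after inverting
    \<open>?M\<close>.\<close>
  have "\<exists>q\<in>Spec1 S. q \<inter> ?M = {} \<and> c \<in> q"
  proof (rule ccontr)
    assume no: "\<not> ?thesis"
    have "\<exists>t\<in>?M. c divides \<one> \<otimes> t"
    proof (rule S.gkd_localization[OF gkd M S.one_closed c(1) False])
      fix q assume "q \<in> Spec1 S" "q \<inter> ?M = {}"
      then have "c \<in> carrier S - q" using no c(1) by blast
      moreover have "c divides \<one> \<otimes> c" using c(1) by simp
      ultimately show "\<exists>d\<in>carrier S - q. c divides \<one> \<otimes> d" by blast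
    qed
    then obtain t y where t: "t \<in> carrier S" "\<sigma> t \<in> L" "\<sigma> t \<notin> P" and y: "y \<in> carrier S" "t = c \<otimes> y"
      by (auto elim!: dividesE)
    obtain n f where f: "\<And>i. i < (n::nat) \<Longrightarrow> f i \<in> R"
      and e: "y [^] n \<oplus> (\<Oplus>i\<in>{..<n}. f i \<otimes> y [^] i) \<in> J"
      using integral[OF y(1)] by metis
    have fS: "f i \<in> carrier S" if "i < n" for i using f[OF that] by simp
    \<comment> \<open>\<open>P0\<close> is the trace of \<open>P\<close> on \<open>S\<close>. Since
      \<open>S\<close> need not map into \<open>L\<close>, it absorbs only factors whose image lies
      in \<open>L\<close>.\<close>
    define P0 where "P0 = {s \<in> carrier S. \<sigma> s \<in> P}"
    have P0_mult: "s \<otimes> u \<in> P0" if "s \<in> P0" "u \<in> carrier S" "\<sigma> u \<in> L" for s u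
      using that P' K.Spec_subring_mult_iff[OF L P, of "\<sigma> s" "\<sigma> u"] by (auto simp: P0_def)
    have P0_add: "s \<oplus> u \<in> P0" if "s \<in> P0" "u \<in> P0" for s u
      using that P' by (auto simp: P0_def)
    have powL: "\<sigma> (s [^] (k::nat)) \<in> L" if "s \<in> carrier S" "\<sigma> s \<in> L" for s k
      by (induction k) (use that subringE(3,6)[OF L] in auto)
    have cP0: "c \<in> P0" using c by (simp add: P0_def)
    have cpow: "c [^] k \<in> P0" if "0 < k" for k :: nat
      using that
    proof (induction k)
      case (Suc k)
      have "c \<otimes> c [^] k \<in> P0" by (rule P0_mult[OF cP0]) (use c cL powL in auto)
      then show ?case using c(1) by (simp add: S.m_comm)
    qed simp
    have tpow: "t [^] k \<notin> P0" for k :: nat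
    proof (induction k)
      case 0
      then show ?case using P' by (simp add: P0_def)
    next
      case (Suc k)
      then show ?case using K.Spec_subring_mult_iff[OF L P powL[OF t(1,2), of k] t(2)] t
        by (simp add: P0_def)
    qed
    \<comment> \<open>An integral equation for \<open>y\<close>, multiplied by \<open>c\<^sup>n\<close>, expresses \<open>t\<^sup>n = c\<^sup>n y\<^sup>n\<close> through
      elements of the prime \<open>P0\<close>.\<close>
    have sum: "c [^] n \<otimes> (\<Oplus>i\<in>{..<k}. f i \<otimes> y [^] i) \<in> P0" if "k \<le> n" for k
      using that
    proof (induction k)
      case 0
      then show ?case using P' c(1) by (simp add: P0_def)
    next
      case (Suc k)
      have fk: "f k \<in> carrier S" "\<sigma> (f k) \<in> L" using f[of k] Suc.prems by auto
      have cl: "(\<Oplus>i\<in>{..<k}. f i \<otimes> y [^] i) \<in> carrier S"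
        using fS Suc.prems y(1) by (intro S.finsum_closed) auto
      have "(\<Oplus>i\<in>{..<Suc k}. f i \<otimes> y [^] i) = f k \<otimes> y [^] k \<oplus> (\<Oplus>i\<in>{..<k}. f i \<otimes> y [^] i)"
        unfolding lessThan_Suc
        by (rule S.finsum_insert) (use fS Suc.prems y(1) in auto)
      then have "c [^] n \<otimes> (\<Oplus>i\<in>{..<Suc k}. f i \<otimes> y [^] i) =
          c [^] n \<otimes> (f k \<otimes> y [^] k) \<oplus> c [^] n \<otimes> (\<Oplus>i\<in>{..<k}. f i \<otimes> y [^] i)"
        using c(1) fk(1) y(1) cl by (simp add: S.r_distr)
      moreover have "c [^] n \<otimes> (f k \<otimes> y [^] k) \<in> P0"
      proof -
        \<comment> \<open>Here \<open>k < n\<close>, so after turning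
          \<open>c [^] k \<otimes> y [^] k\<close> into \<open>t [^] k\<close> a positive power of
          \<open>c\<close> remains and keeps the term in \<open>P0\<close>.\<close>
        have "c [^] n = c [^] (n - k) \<otimes> c [^] k"
          using c(1) Suc.prems by (simp add: S.nat_pow_mult)
        then have "c [^] n \<otimes> (f k \<otimes> y [^] k) = c [^] (n - k) \<otimes> (f k \<otimes> t [^] k)"
          using c(1) fk(1) y by (simp add: S.nat_pow_distrib S.m_ac)
        moreover have "\<sigma> (f k \<otimes> t [^] k) \<in> L"
          using fk t(1) subringE(6)[OF L fk(2) powL[OF t(1,2), of k]] by simp
        ultimately show ?thesis
          using P0_mult[OF cpow[of "n - k"], of "f k \<otimes> t [^] k"] fk(1) t(1) Suc.prems by simp
      qed
      ultimately show ?case using P0_add Suc by simp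
    qed
    have S_cl: "(\<Oplus>i\<in>{..<n}. f i \<otimes> y [^] i) \<in> carrier S"
      using fS y(1) by (intro S.finsum_closed) auto
    show False
    proof (cases "n = 0")
      case True
      \<comment> \<open>For \<open>n = 0\<close> no factor \<open>c\<close> is available. The
        equation then reads \<open>\<one> \<in> J\<close>, so \<open>y \<in> R\<close> and already
        \<open>t = c \<otimes> y\<close> lies in \<open>P0\<close>.\<close>
      then have "\<one> \<in> J" using e by simp
      then have "y \<in> R" using J_mult(1)[of \<one> y] y(1) JR by auto
      then have "t \<in> P0" unfolding y(2) by (intro P0_mult[OF cP0]) auto
      then show False using t by (simp add: P0_def)
    next
      case False
      let ?e = "y [^] n \<oplus> (\<Oplus>i\<in>{..<n}. f i \<otimes> y [^] i)" and ?s = "\<Oplus>i\<in>{..<n}. f i \<otimes> y [^] i"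
      \<comment> \<open>\<open>?e\<close> lies in \<open>J\<close>, hence in \<open>R\<close>, so it
        is an admissible factor. Subtracting the lower terms leaves \<open>t [^] n\<close> in
        \<open>P0\<close>.\<close>
      have "c [^] n \<otimes> ?e \<in> P0"
        by (rule P0_mult) (use cpow False e JR in auto)
      moreover have "c [^] n \<otimes> ?e = t [^] n \<oplus> c [^] n \<otimes> ?s"
        using c(1) y S_cl by (simp add: S.nat_pow_distrib S.r_distr)
      moreover have "\<ominus> (c [^] n \<otimes> ?s) \<in> P0"
      proof -
        have "\<ominus> \<one> \<in> R" using subringE(3,5)[OF R] by simp
        then have "c [^] n \<otimes> ?s \<otimes> \<ominus> \<one> \<in> P0" by (intro P0_mult[OF sum]) auto
        then show ?thesis using c(1) S_cl by (simp add: S.r_minus)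
      qed
      ultimately have "(t [^] n \<oplus> c [^] n \<otimes> ?s) \<oplus> \<ominus> (c [^] n \<otimes> ?s) \<in> P0"
        using P0_add by simp
      moreover have "(t [^] n \<oplus> c [^] n \<otimes> ?s) \<oplus> \<ominus> (c [^] n \<otimes> ?s) = t [^] n"
        using c(1) t(1) S_cl by (simp add: S.a_assoc S.r_neg)
      ultimately show False using tpow[of n] by simp
    qed
  qed
  then obtain q where q: "q \<in> Spec1 S" "q \<inter> ?M = {}" "c \<in> q" by (elim bexE conjE)
  have "\<sigma> r \<in> Q" if "r \<in> q \<inter> R" for r
  proof -
    have "r \<notin> ?M" using that q(2) by blast
    then have "\<sigma> r \<in> P" using that by simp
    then show ?thesis using PQ that by blast
  qed
  from going_down_prime[OF Spec1_Spec[OF q(1)] Q this] obtain Q1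
    where Q1: "Q1 \<in> Spec (K\<lparr>carrier := L\<rparr>)" "Q1 \<subseteq> Q" "\<And>r. r \<in> R \<Longrightarrow> \<sigma> r \<in> Q1 \<longleftrightarrow> r \<in> q" by metis
  \<comment> \<open>\<open>Q1\<close> is known only on \<open>R\<close>. Multiplying
    \<open>c\<close> by \<open>j \<in> J\<close> outside \<open>q\<close> moves it into
    \<open>R\<close>, and primality of \<open>Q1\<close> cancels \<open>j\<close>.\<close>
  obtain j where j: "j \<in> J" "j \<notin> q" using height[OF q(1)] by blast
  have jR: "j \<in> R" "j \<otimes> c \<in> R" using J_mult(1)[OF j(1)] c(1) j(1) JR by auto
  have "j \<otimes> c \<in> q" using q(3) jR Spec1_Spec[OF q(1), unfolded S.Spec_iff] by simp
  then have "\<sigma> j \<otimes>\<^bsub>K\<^esub> \<sigma> c \<in> Q1" using Q1(3)[OF jR(2)] jR(1) c(1) by simp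
  then have "\<sigma> c \<in> Q1"
    using K.Spec_subring_mult_iff[OF L Q1(1) sigma_L[OF jR(1)] cL] Q1(3)[OF jR(1)] j(2) by simp
  then show ?thesis using Q1(2) by blast
qed

text \<open>One inclusion holds because elements of \<open>R\<close> outside \<open>m\<close> are
  units of \<open>L\<close>. For the other, \<open>x\<close> is written as \<open>c/t\<close> with
  \<open>c \<in> S\<close>; either an element of \<open>J\<close> serves as an extra denominator, or
  the fraction is reduced modulo \<open>J\<close>, where fragility leaves no room for anything
  beyond the localization of \<open>A\<close>.\<close>

lemma overring_eq_localization:
  assumes m: "m \<in> Spec (K\<lparr>carrier := L\<rparr>)"
    and unit: "\<And>x. x \<in> L \<Longrightarrow> x \<notin> m \<Longrightarrow> \<exists>y\<in>L. x \<otimes>\<^bsub>K\<^esub> y = \<one>\<^bsub>K\<^esub>"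
    and A: "subring A (S Quot J)" and R_eq: "R = pullback S J A"
    and int: "integral_extension A (S Quot J)" and frag: "fragile A (S Quot J)"
  shows "L = {x \<in> carrier K. \<exists>a\<in>R. \<exists>t\<in>R. \<sigma> t \<notin> m \<and> x \<otimes>\<^bsub>K\<^esub> \<sigma> t = \<sigma> a}"
proof (rule subset_antisym; rule subsetI)
  fix x assume "x \<in> {x \<in> carrier K. \<exists>a\<in>R. \<exists>t\<in>R. \<sigma> t \<notin> m \<and> x \<otimes>\<^bsub>K\<^esub> \<sigma> t = \<sigma> a}"
  then obtain a t where x: "x \<in> carrier K" and t: "t \<in> R" "\<sigma> t \<notin> m" and a: "a \<in> R" "x \<otimes>\<^bsub>K\<^esub> \<sigma> t = \<sigma> a"
    by blast
  obtain y where y: "y \<in> L" "\<sigma> t \<otimes>\<^bsub>K\<^esub> y = \<one>\<^bsub>K\<^esub>" using unit[of "\<sigma> t"] t by auto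
  have "x = x \<otimes>\<^bsub>K\<^esub> \<sigma> t \<otimes>\<^bsub>K\<^esub> y" using x t y by (simp add: K.m_assoc)
  then show "x \<in> L" using a y subringE(6)[OF L] by simp
next
  note m' = m[unfolded K.Spec_subring_iff[OF L]]
  let ?Rp = "{x \<in> carrier K. \<exists>a\<in>R. \<exists>t\<in>R. \<sigma> t \<notin> m \<and> x \<otimes>\<^bsub>K\<^esub> \<sigma> t = \<sigma> a}"
  \<comment> \<open>\<open>U\<close> is the complement in \<open>R\<close> of the prime
    \<open>p\<close> to which \<open>m\<close> contracts. Its elements are units of
    \<open>L\<close>, so by \<open>U_notin\<close> they avoid every prime of
    \<open>L\<close>.\<close>
  define U where "U = {t \<in> R. \<sigma> t \<notin> m}"
  have U_mult: "s \<otimes> t \<in> U" if "s \<in> U" "t \<in> U" for s t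
    using that K.Spec_subring_mult_iff[OF L m, of "\<sigma> s" "\<sigma> t"] subringE(6)[OF R] by (auto simp: U_def)
  have U_S: "t \<in> carrier S" if "t \<in> U" for t using that by (simp add: U_def)
  have U_R: "t \<in> R" if "t \<in> U" for t using that by (simp add: U_def)
  have one_U: "\<one> \<in> U" using m' subringE(3)[OF R] by (simp add: U_def)
  have U_nz: "t \<noteq> \<zero>" if "t \<in> U" for t using that m' by (auto simp: U_def)
  have U_notin: "\<sigma> t \<notin> P" if "t \<in> U" "P \<in> Spec (K\<lparr>carrier := L\<rparr>)" for t P
  proof
    assume t: "\<sigma> t \<in> P"
    obtain y where y: "y \<in> L" "\<sigma> t \<otimes>\<^bsub>K\<^esub> y = \<one>\<^bsub>K\<^esub>" using unit[of "\<sigma> t"] \<open>t \<in> U\<close> by (auto simp: U_def)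
    then have "\<one>\<^bsub>K\<^esub> \<in> P"
      using K.Spec_subring_mult_iff[OF L that(2), of "\<sigma> t" y] t \<open>t \<in> U\<close> by (simp add: U_def)
    then show False using that(2)[unfolded K.Spec_subring_iff[OF L]] by simp
  qed
  have den: "\<exists>c\<in>carrier S. \<exists>t\<in>U. x \<otimes>\<^bsub>K\<^esub> \<sigma> t = \<sigma> c" if "x \<in> L" for x
    using overring_denominator[OF m that] unfolding U_def by auto
  fix x assume x: "x \<in> L"
  show "x \<in> ?Rp"
  proof (cases "J \<inter> U = {}")
    case False
    \<comment> \<open>If \<open>J\<close> is not inside \<open>p\<close>, expanding
      \<open>c/t\<close> by such a \<open>j\<close> puts the numerator into \<open>J\<close>, hence
      into \<open>R\<close>.\<close>
    then obtain j where j: "j \<in> J" "j \<in> U" by blast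
    obtain c t where c: "c \<in> carrier S" and t: "t \<in> U" "x \<otimes>\<^bsub>K\<^esub> \<sigma> t = \<sigma> c"
      using den[OF x] by blast
    have "x \<otimes>\<^bsub>K\<^esub> \<sigma> (t \<otimes> j) = x \<otimes>\<^bsub>K\<^esub> \<sigma> t \<otimes>\<^bsub>K\<^esub> \<sigma> j"
      using x U_S[OF t(1)] U_S[OF j(2)] by (simp add: K.m_assoc)
    also have "\<dots> = \<sigma> (c \<otimes> j)" using t(2) c U_S[OF j(2)] by simp
    finally have "x \<otimes>\<^bsub>K\<^esub> \<sigma> (t \<otimes> j) = \<sigma> (c \<otimes> j)" .
    moreover have "c \<otimes> j \<in> R" using J_mult(2)[OF j(1) c] JR by blast
    ultimately show ?thesis using U_mult[OF t(1) j(2)] L_carrier[OF x] unfolding U_def by blast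
  next
    case JU: True
    let ?B = "S Quot J"
    define \<pi> where "\<pi> = (+>) J"
    interpret J: ideal J S by (rule J)
    interpret B: cring ?B by (rule J.quotient_is_cring[OF S.is_cring])
    interpret \<pi>: ring_hom_cring S ?B \<pi>
      unfolding \<pi>_def by (rule J.rcos_ring_hom_cring[OF S.is_cring])
    have pi_eq: "\<pi> s = \<pi> t \<longleftrightarrow> s \<ominus> t \<in> J" if "s \<in> carrier S" "t \<in> carrier S" for s t
      using S.quotient_eq_iff_same_a_r_cos[OF J that] unfolding \<pi>_def by simp
    have R_iff: "s \<in> R \<longleftrightarrow> s \<in> carrier S \<and> \<pi> s \<in> A" for s
      unfolding R_eq pullback_def \<pi>_def by simp
    have pi_surj: "\<exists>s\<in>carrier S. y = \<pi> s" if "y \<in> carrier ?B" for y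
      using that unfolding \<pi>_def FactRing_def A_RCOSETS_def' by auto
    have A_eq: "A = \<pi> ` R"
      using R_iff pi_surj subringE(1)[OF A] by blast
    \<comment> \<open>As \<open>J\<close> lies in \<open>p\<close>, membership in \<open>U\<close>
      depends only on the class modulo \<open>J\<close>.\<close>
    have pi_U: "\<pi> t \<in> \<pi> ` U \<longleftrightarrow> t \<in> U" if "t \<in> R" for t
    proof
      assume "\<pi> t \<in> \<pi> ` U"
      then obtain u where u: "u \<in> U" "\<pi> t = \<pi> u" by blast
      then have j: "u \<ominus> t \<in> J" using pi_eq[of u t] that U_S by simp
      show "t \<in> U"
      proof (rule ccontr)
        assume "t \<notin> U"
        then have "\<sigma> t \<in> m" using that by (simp add: U_def)
        moreover have "\<sigma> (u \<ominus> t) \<in> m" using j JU JR by (auto simp: U_def)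
        ultimately have "\<sigma> (u \<ominus> t) \<oplus>\<^bsub>K\<^esub> \<sigma> t \<in> m" using m' by simp
        moreover have "(u \<ominus> t) \<oplus> t = u"
          using U_S[OF u(1)] that by (simp add: S.minus_eq S.a_assoc S.l_neg)
        then have "\<sigma> (u \<ominus> t) \<oplus>\<^bsub>K\<^esub> \<sigma> t = \<sigma> u"
          using U_S[OF u(1)] that by (subst sigma_simps(3)[symmetric]) auto
        ultimately show False using u(1) by (simp add: U_def)
      qed
    qed blast
    let ?M = "\<pi> ` U"
    have M: "submonoid ?M ?B"
    proof (rule submonoid.intro)
      show "?M \<subseteq> carrier ?B" using U_S by auto
      fix x y assume "x \<in> ?M" "y \<in> ?M"
      then show "x \<otimes>\<^bsub>?B\<^esub> y \<in> ?M" using U_mult U_S by (auto simp flip: \<pi>.hom_mult)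
    next
      show "\<one>\<^bsub>?B\<^esub> \<in> ?M" using one_U by (auto simp flip: \<pi>.hom_one)
    qed
    \<comment> \<open>Fragility speaks of complements of primes of \<open>A\<close>. The prime in
      question is \<open>A - ?M\<close>, the image of \<open>p\<close>, whose complement is
      \<open>?M\<close> again.\<close>
    have AM: "A - (A - ?M) = ?M" using A_eq U_R by blast
    have AM_Spec: "A - ?M \<in> Spec (?B\<lparr>carrier := A\<rparr>)"
      unfolding B.Spec_subring_iff[OF A]
    proof (intro conjI ballI impI)
      have mem: "\<pi> r \<in> A - ?M \<longleftrightarrow> \<sigma> r \<in> m" if "r \<in> R" for r
        using that pi_U[OF that] A_eq by (auto simp: U_def)
      have get: "\<exists>r\<in>R. y = \<pi> r" if "y \<in> A" for y using that A_eq by blast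
      show "A - ?M \<subseteq> A" by blast
      show "\<zero>\<^bsub>?B\<^esub> \<in> A - ?M" using mem[of \<zero>] subringE(2)[OF R] m' by simp
      show "\<one>\<^bsub>?B\<^esub> \<notin> A - ?M" using mem[of \<one>] subringE(3)[OF R] m' by simp
      {
        fix y z assume y: "y \<in> A - ?M" and z: "z \<in> A - ?M"
        obtain r s where rs: "r \<in> R" "y = \<pi> r" "s \<in> R" "z = \<pi> s" using get y z by blast
        show "y \<oplus>\<^bsub>?B\<^esub> z \<in> A - ?M"
          using mem[OF rs(1)] mem[OF rs(3)] mem[OF subringE(7)[OF R rs(1,3)]] rs y z m' by simp
      next
        fix y z assume y: "y \<in> A - ?M" and z: "z \<in> A"
        obtain r s where rs: "r \<in> R" "y = \<pi> r" "s \<in> R" "z = \<pi> s" using get y z by blast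
        show "z \<otimes>\<^bsub>?B\<^esub> y \<in> A - ?M"
          using mem[OF rs(1)] mem[OF subringE(6)[OF R rs(3,1)]] rs y m' by simp
      next
        fix y z assume y: "y \<in> A" and z: "z \<in> A" and yz: "y \<otimes>\<^bsub>?B\<^esub> z \<in> A - ?M"
        obtain r s where rs: "r \<in> R" "y = \<pi> r" "s \<in> R" "z = \<pi> s" using get y z by blast
        show "y \<in> A - ?M \<or> z \<in> A - ?M"
          using mem[OF rs(1)] mem[OF rs(3)] mem[OF subringE(6)[OF R rs(1,3)]] rs yz
            K.Spec_subring_mult_iff[OF L m sigma_L[OF rs(1)] sigma_L[OF rs(3)]] by simp
      }
    qed
    let ?B' = "localization ?B ?M" and ?f = "loc_frac ?B ?M"
    let ?A' = "fractions ?B ?M A ?M"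
    interpret B': cring ?B' by (rule B.localization_cring[OF M])
    have af: "apparently_fragile ?A' ?B'"
      using frag AM_Spec AM unfolding fragile_def by metis
    \<comment> \<open>\<open>\<phi>\<close> reduces a fraction \<open>c/t\<close> modulo
      \<open>J\<close>. The choice is harmless: two representations of \<open>x\<close> give equal
      cross products in \<open>S\<close>, by injectivity of \<open>\<sigma>\<close>.\<close>
    define \<phi> where "\<phi> x = (SOME y. \<exists>c\<in>carrier S. \<exists>t\<in>U. x \<otimes>\<^bsub>K\<^esub> \<sigma> t = \<sigma> c \<and> y = ?f (\<pi> c) (\<pi> t))" for x
    have phi: "\<phi> x = ?f (\<pi> c) (\<pi> t)"
      if x: "x \<in> L" and c: "c \<in> carrier S" and t: "t \<in> U" and e: "x \<otimes>\<^bsub>K\<^esub> \<sigma> t = \<sigma> c" for x c t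
      unfolding \<phi>_def
    proof (rule some_equality)
      show "\<exists>c'\<in>carrier S. \<exists>t'\<in>U. x \<otimes>\<^bsub>K\<^esub> \<sigma> t' = \<sigma> c' \<and> ?f (\<pi> c) (\<pi> t) = ?f (\<pi> c') (\<pi> t')"
        using c t e by blast
      fix y assume "\<exists>c'\<in>carrier S. \<exists>t'\<in>U. x \<otimes>\<^bsub>K\<^esub> \<sigma> t' = \<sigma> c' \<and> y = ?f (\<pi> c') (\<pi> t')"
      then obtain c' t' where c': "c' \<in> carrier S" and t': "t' \<in> U" and e': "x \<otimes>\<^bsub>K\<^esub> \<sigma> t' = \<sigma> c'"
        and y: "y = ?f (\<pi> c') (\<pi> t')" by blast
      have "\<sigma> (c' \<otimes> t) = x \<otimes>\<^bsub>K\<^esub> \<sigma> t' \<otimes>\<^bsub>K\<^esub> \<sigma> t" using e' c' U_S[OF t] by simp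
      also have "\<dots> = x \<otimes>\<^bsub>K\<^esub> \<sigma> t \<otimes>\<^bsub>K\<^esub> \<sigma> t'" using x U_S[OF t] U_S[OF t'] by (simp add: K.m_ac)
      also have "\<dots> = \<sigma> (c \<otimes> t')" using e c U_S[OF t'] by simp
      finally have "c' \<otimes> t = c \<otimes> t'"
        by (rule inj_onD[OF inj]) (use c c' U_S[OF t] U_S[OF t'] in simp_all)
      then have "\<pi> c' \<otimes>\<^bsub>?B\<^esub> \<pi> t = \<pi> c \<otimes>\<^bsub>?B\<^esub> \<pi> t'"
        using c c' U_S[OF t] U_S[OF t'] by (simp flip: \<pi>.hom_mult)
      then show "y = ?f (\<pi> c) (\<pi> t)"
        unfolding y using c c' t t' one_U
        by (subst B.loc_frac_eq_iff[OF M]) auto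
    qed
    have frac_B': "?f (\<pi> c) (\<pi> t) \<in> carrier ?B'" if "c \<in> carrier S" "t \<in> U" for c t
      using that by (auto simp: localization_def fractions_def)
    have phi_hom: "\<phi> \<in> ring_hom (K\<lparr>carrier := L\<rparr>) ?B'"
    proof (rule ring_hom_memI; simp)
      fix x assume x: "x \<in> L"
      then obtain c t where ct: "c \<in> carrier S" "t \<in> U" "x \<otimes>\<^bsub>K\<^esub> \<sigma> t = \<sigma> c" using den by blast
      show "\<phi> x \<in> carrier ?B'" using phi[OF x ct] frac_B' ct by simp
      fix y assume y: "y \<in> L"
      then obtain d u where du: "d \<in> carrier S" "u \<in> U" "y \<otimes>\<^bsub>K\<^esub> \<sigma> u = \<sigma> d" using den by blast
      have S: "t \<in> carrier S" "u \<in> carrier S" using ct du U_S by auto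
      have "x \<otimes>\<^bsub>K\<^esub> y \<otimes>\<^bsub>K\<^esub> \<sigma> (t \<otimes> u) = (x \<otimes>\<^bsub>K\<^esub> \<sigma> t) \<otimes>\<^bsub>K\<^esub> (y \<otimes>\<^bsub>K\<^esub> \<sigma> u)"
        using x y S by (simp add: K.m_ac)
      also have "\<dots> = \<sigma> (c \<otimes> d)" using ct du by simp
      finally have "\<phi> (x \<otimes>\<^bsub>K\<^esub> y) = ?f (\<pi> (c \<otimes> d)) (\<pi> (t \<otimes> u))"
        using ct du U_mult subringE(6)[OF L x y] by (intro phi) auto
      also have "\<dots> = ?f (\<pi> c) (\<pi> t) \<otimes>\<^bsub>?B'\<^esub> ?f (\<pi> d) (\<pi> u)"
        using ct du S by (subst B.loc_frac_mult[OF M]) auto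
      finally show "\<phi> (x \<otimes>\<^bsub>K\<^esub> y) = \<phi> x \<otimes>\<^bsub>?B'\<^esub> \<phi> y"
        using phi[OF x ct] phi[OF y du] by simp
      have "(x \<oplus>\<^bsub>K\<^esub> y) \<otimes>\<^bsub>K\<^esub> \<sigma> (t \<otimes> u) =
          (x \<otimes>\<^bsub>K\<^esub> \<sigma> t) \<otimes>\<^bsub>K\<^esub> \<sigma> u \<oplus>\<^bsub>K\<^esub> (y \<otimes>\<^bsub>K\<^esub> \<sigma> u) \<otimes>\<^bsub>K\<^esub> \<sigma> t"
        using x y S by (simp add: K.m_ac K.l_distr K.r_distr)
      also have "\<dots> = \<sigma> (c \<otimes> u \<oplus> d \<otimes> t)" using ct du S by simp
      finally have "\<phi> (x \<oplus>\<^bsub>K\<^esub> y) = ?f (\<pi> (c \<otimes> u \<oplus> d \<otimes> t)) (\<pi> (t \<otimes> u))"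
        using ct du U_mult subringE(7)[OF L x y] S by (intro phi) auto
      also have "\<dots> = ?f (\<pi> c) (\<pi> t) \<oplus>\<^bsub>?B'\<^esub> ?f (\<pi> d) (\<pi> u)"
        using ct du S by (subst B.loc_frac_add[OF M]) auto
      finally show "\<phi> (x \<oplus>\<^bsub>K\<^esub> y) = \<phi> x \<oplus>\<^bsub>?B'\<^esub> \<phi> y"
        using phi[OF x ct] phi[OF y du] by simp
    next
      show "\<phi> \<one>\<^bsub>K\<^esub> = \<one>\<^bsub>?B'\<^esub>"
        using phi[of "\<one>\<^bsub>K\<^esub>" \<one> \<one>] one_U subringE(3)[OF L] by (simp add: localization_def)
    qed
    interpret \<phi>: ring_hom_ring "K\<lparr>carrier := L\<rparr>" ?B' \<phi>
      by (rule ring_hom_ringI2[OF K.subring_is_ring[OF L] B'.ring_axioms phi_hom])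
    define C where "C = \<phi> ` L"
    have C: "subring C ?B'"
      using \<phi>.img_is_subring[OF \<phi>.R.carrier_is_subring] by (simp add: C_def)
    \<comment> \<open>Denominators from \<open>U\<close> are invertible in \<open>L\<close>, so each
      fraction \<open>a/t\<close> with \<open>a \<in> R\<close> comes from an element of
      \<open>L\<close>.\<close>
    have A'C: "?A' \<subseteq> C"
    proof
      fix z assume "z \<in> ?A'"
      then obtain a t where at: "a \<in> R" "t \<in> U" "z = ?f (\<pi> a) (\<pi> t)"
        unfolding fractions_def A_eq by blast
      obtain y where y: "y \<in> L" "\<sigma> t \<otimes>\<^bsub>K\<^esub> y = \<one>\<^bsub>K\<^esub>" using unit[of "\<sigma> t"] at(2) by (auto simp: U_def)
      have ay: "\<sigma> a \<otimes>\<^bsub>K\<^esub> y \<in> L" using subringE(6)[OF L] at(1) y(1) by simp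
      have "\<sigma> a \<otimes>\<^bsub>K\<^esub> y \<otimes>\<^bsub>K\<^esub> \<sigma> t = \<sigma> a \<otimes>\<^bsub>K\<^esub> (\<sigma> t \<otimes>\<^bsub>K\<^esub> y)"
        using at(1) U_S[OF at(2)] y(1) by (simp add: K.m_ac)
      then have "\<sigma> a \<otimes>\<^bsub>K\<^esub> y \<otimes>\<^bsub>K\<^esub> \<sigma> t = \<sigma> a" using at(1) by (simp add: y(2))
      then have "\<phi> (\<sigma> a \<otimes>\<^bsub>K\<^esub> y) = z" using phi[OF ay R_carrier[OF at(1)] at(2)] at(3) by simp
      then show "z \<in> C" using ay unfolding C_def by blast
    qed
    \<comment> \<open>After multiplication by some \<open>u \<in> U\<close>, the cross products
      agree modulo \<open>J\<close>. Since \<open>R\<close> is the full preimage of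
      \<open>A\<close>, the numerator coming from \<open>S\<close> then lies in
      \<open>R\<close>.\<close>
    have phi_A': "y \<in> ?Rp" if y: "y \<in> L" "\<phi> y \<in> ?A'" for y
    proof -
      obtain c t where ct: "c \<in> carrier S" "t \<in> U" "y \<otimes>\<^bsub>K\<^esub> \<sigma> t = \<sigma> c" using den[OF y(1)] by blast
      obtain a s where as: "a \<in> R" "s \<in> U" "\<phi> y = ?f (\<pi> a) (\<pi> s)"
        using y(2) unfolding fractions_def A_eq by blast
      have S: "t \<in> carrier S" "s \<in> carrier S" "a \<in> carrier S" using ct as U_S by auto
      have "?f (\<pi> c) (\<pi> t) = ?f (\<pi> a) (\<pi> s)" using as(3) phi[OF y(1) ct] by simp
      then obtain u where u: "u \<in> U" "\<pi> u \<otimes>\<^bsub>?B\<^esub> (\<pi> c \<otimes>\<^bsub>?B\<^esub> \<pi> s) = \<pi> u \<otimes>\<^bsub>?B\<^esub> (\<pi> a \<otimes>\<^bsub>?B\<^esub> \<pi> t)"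
        using ct as S by (subst (asm) B.loc_frac_eq_iff[OF M]) auto
      have "\<pi> (u \<otimes> (c \<otimes> s)) = \<pi> (u \<otimes> (a \<otimes> t))"
        using u U_S[OF u(1)] ct(1) S by simp
      moreover have "u \<otimes> (a \<otimes> t) \<in> R" using subringE(6)[OF R] as(1) U_R u(1) ct(2) by simp
      ultimately have ucs: "u \<otimes> (c \<otimes> s) \<in> R"
        using R_iff U_S[OF u(1)] ct(1) S by simp
      have "y \<otimes>\<^bsub>K\<^esub> \<sigma> (u \<otimes> (t \<otimes> s)) = \<sigma> u \<otimes>\<^bsub>K\<^esub> ((y \<otimes>\<^bsub>K\<^esub> \<sigma> t) \<otimes>\<^bsub>K\<^esub> \<sigma> s)"
        using y(1) U_S[OF u(1)] S by (simp add: K.m_ac)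
      also have "\<dots> = \<sigma> (u \<otimes> (c \<otimes> s))" unfolding ct(3) using U_S[OF u(1)] ct(1) S by simp
      finally have "y \<otimes>\<^bsub>K\<^esub> \<sigma> (u \<otimes> (t \<otimes> s)) = \<sigma> (u \<otimes> (c \<otimes> s))" .
      moreover have "u \<otimes> (t \<otimes> s) \<in> U" using U_mult u(1) ct(2) as(2) by simp
      ultimately show ?thesis using ucs L_carrier[OF y(1)] unfolding U_def by blast
    qed
    \<comment> \<open>The coefficients of an integral equation over \<open>A\<close> are lifted to
      \<open>R\<close>; the equation survives modulo \<open>J\<close>.\<close>
    have int_S: "\<exists>(n::nat) f. (\<forall>i<n. f i \<in> R) \<and> y [^] n \<oplus> (\<Oplus>i\<in>{..<n}. f i \<otimes> y [^] i) \<in> J"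
      if y: "y \<in> carrier S" for y
    proof -
      have "integral_over ?B A (\<pi> y)" using int y unfolding integral_extension_def by auto
      then obtain n g where g: "\<And>i. i < (n::nat) \<Longrightarrow> g i \<in> A"
        and e: "\<pi> y [^]\<^bsub>?B\<^esub> n \<oplus>\<^bsub>?B\<^esub> (\<Oplus>\<^bsub>?B\<^esub>i\<in>{..<n}. g i \<otimes>\<^bsub>?B\<^esub> \<pi> y [^]\<^bsub>?B\<^esub> i) = \<zero>\<^bsub>?B\<^esub>"
        unfolding integral_over_def by blast
      have "\<exists>f. \<forall>i<n. f i \<in> R \<and> \<pi> (f i) = g i"
        by (rule exI[of _ "\<lambda>i. SOME r. r \<in> R \<and> \<pi> r = g i"], intro allI impI, rule someI_ex)
          (use g A_eq in blast)
      then obtain f where f: "\<And>i. i < n \<Longrightarrow> f i \<in> R" "\<And>i. i < n \<Longrightarrow> \<pi> (f i) = g i" by blast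
      have cl: "f i \<otimes> y [^] i \<in> carrier S" if "i < n" for i using f(1)[OF that] y by simp
      have "\<pi> (\<Oplus>i\<in>{..<n}. f i \<otimes> y [^] i) = (\<Oplus>\<^bsub>?B\<^esub>i\<in>{..<n}. g i \<otimes>\<^bsub>?B\<^esub> \<pi> y [^]\<^bsub>?B\<^esub> i)"
      proof (subst \<pi>.hom_finsum)
        show "(\<lambda>i. f i \<otimes> y [^] i) \<in> {..<n} \<rightarrow> carrier S" using cl by simp
        show "finsum ?B (\<pi> \<circ> (\<lambda>i. f i \<otimes> y [^] i)) {..<n} =
            (\<Oplus>\<^bsub>?B\<^esub>i\<in>{..<n}. g i \<otimes>\<^bsub>?B\<^esub> \<pi> y [^]\<^bsub>?B\<^esub> i)"
        proof (rule B.finsum_cong'[OF refl])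
          show "(\<lambda>i. g i \<otimes>\<^bsub>?B\<^esub> \<pi> y [^]\<^bsub>?B\<^esub> i) \<in> {..<n} \<rightarrow> carrier ?B"
            using g subringE(1)[OF A] y by (intro Pi_I B.m_closed B.nat_pow_closed) auto
          fix i assume "i \<in> {..<n}"
          then show "(\<pi> \<circ> (\<lambda>i. f i \<otimes> y [^] i)) i = g i \<otimes>\<^bsub>?B\<^esub> \<pi> y [^]\<^bsub>?B\<^esub> i"
            using f y by (simp add: \<pi>.ring.hom_nat_pow)
        qed
      qed
      then have "\<pi> (y [^] n \<oplus> (\<Oplus>i\<in>{..<n}. f i \<otimes> y [^] i)) = \<pi> \<zero>"
        using e y cl by (subst \<pi>.hom_add) (auto simp: \<pi>.ring.hom_nat_pow intro!: S.finsum_closed)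
      then have "y [^] n \<oplus> (\<Oplus>i\<in>{..<n}. f i \<otimes> y [^] i) \<ominus> \<zero> \<in> J"
        using y cl by (subst (asm) pi_eq) (auto intro!: S.finsum_closed)
      moreover have "y [^] n \<oplus> (\<Oplus>i\<in>{..<n}. f i \<otimes> y [^] i) \<in> carrier S"
        using y cl by (auto intro!: S.finsum_closed)
      ultimately have "y [^] n \<oplus> (\<Oplus>i\<in>{..<n}. f i \<otimes> y [^] i) \<in> J"
        by (simp add: S.minus_eq)
      then show ?thesis using f(1) by blast
    qed
    \<comment> \<open>If \<open>C\<close> were larger, fragility would give two distinct primes of
      \<open>C\<close> with the same trace on \<open>?A'\<close>. Their preimages in
      \<open>L\<close> coincide, which is impossible because \<open>\<phi>\<close> maps
      \<open>L\<close> onto \<open>C\<close>.\<close>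
    have "?A' = C"
    proof (rule ccontr)
      assume "?A' \<noteq> C"
      then have "?A' \<subset> C" using A'C by blast
      then obtain P Q where P: "P \<in> Spec (?B'\<lparr>carrier := C\<rparr>)" and Q: "Q \<in> Spec (?B'\<lparr>carrier := C\<rparr>)"
        and ne: "P \<noteq> Q" and PQ: "P \<inter> ?A' = Q \<inter> ?A'"
        using af C unfolding apparently_fragile_def by metis
      define pre where "pre P = {x \<in> L. \<phi> x \<in> P}" for P
      have pre: "pre P \<in> Spec (K\<lparr>carrier := L\<rparr>)" if P: "P \<in> Spec (?B'\<lparr>carrier := C\<rparr>)" for P
      proof -
        note P' = P[unfolded B'.Spec_subring_iff[OF C]]
        have hom': "\<phi> x \<in> C" "\<phi> (x \<oplus>\<^bsub>K\<^esub> y) = \<phi> x \<oplus>\<^bsub>?B'\<^esub> \<phi> y" "\<phi> (x \<otimes>\<^bsub>K\<^esub> y) = \<phi> x \<otimes>\<^bsub>?B'\<^esub> \<phi> y"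
          if "x \<in> L" "y \<in> L" for x y
          using that \<phi>.hom_add[of x y] \<phi>.hom_mult[of x y] by (simp_all add: C_def)
        have "\<phi> \<zero>\<^bsub>K\<^esub> = \<zero>\<^bsub>?B'\<^esub>" "\<phi> \<one>\<^bsub>K\<^esub> = \<one>\<^bsub>?B'\<^esub>" using \<phi>.hom_zero \<phi>.hom_one by simp_all
        then show ?thesis
          unfolding K.Spec_subring_iff[OF L] pre_def
          using P' hom' subringE(2,3,6,7)[OF L] by simp
      qed
      \<comment> \<open>\<open>\<phi>\<close> sends the image of \<open>R\<close> into
        \<open>?A'\<close>, where \<open>P\<close> and \<open>Q\<close> agree.\<close>
      have contr: "pre P \<inter> \<sigma> ` R = pre Q \<inter> \<sigma> ` R"
      proof -
        have "\<phi> (\<sigma> r) \<in> ?A'" if r: "r \<in> R" for r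
        proof -
          have "\<phi> (\<sigma> r) = ?f (\<pi> r) (\<pi> \<one>)"
            using phi[OF sigma_L[OF r] R_carrier[OF r] one_U] r by simp
          then show ?thesis using r one_U unfolding fractions_def A_eq by blast
        qed
        then have "\<phi> (\<sigma> r) \<in> P \<longleftrightarrow> \<phi> (\<sigma> r) \<in> Q" if "r \<in> R" for r
          using PQ that by blast
        then show ?thesis unfolding pre_def by auto
      qed
      \<comment> \<open>Writing \<open>y = c/t\<close>, the unit \<open>\<sigma> t\<close> does not
        matter for membership in a prime of \<open>L\<close>, so only the numerator
        \<open>c \<in> S\<close> has to be compared.\<close>
      have mono: "pre P \<subseteq> pre Q"
        if P: "pre P \<in> Spec (K\<lparr>carrier := L\<rparr>)" and Q: "pre Q \<in> Spec (K\<lparr>carrier := L\<rparr>)"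
          and contr: "pre P \<inter> \<sigma> ` R = pre Q \<inter> \<sigma> ` R" for P Q
      proof
        fix y assume yP: "y \<in> pre P"
        then have y: "y \<in> L" by (simp add: pre_def)
        obtain c t where ct: "c \<in> carrier S" "t \<in> U" "y \<otimes>\<^bsub>K\<^esub> \<sigma> t = \<sigma> c" using den[OF y] by blast
        have tL: "\<sigma> t \<in> L" using ct(2) by (simp add: U_def)
        have "\<sigma> c \<in> pre P"
          using K.Spec_subring_mult_iff[OF L P y tL] yP by (simp add: ct(3))
        then have "\<sigma> c \<in> pre Q" using contraction_determines_numerators[OF P Q contr _ ct(1)] int_S by blast
        then show "y \<in> pre Q"
          using K.Spec_subring_mult_iff[OF L Q y tL] U_notin[OF ct(2) Q] by (simp add: ct(3))
      qed
      have "pre P = pre Q"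
        using mono[OF pre[OF P] pre[OF Q] contr] mono[OF pre[OF Q] pre[OF P] contr[symmetric]] by blast
      moreover have "P = \<phi> ` pre P" if "P \<in> Spec (?B'\<lparr>carrier := C\<rparr>)" for P
        using that[unfolded B'.Spec_subring_iff[OF C]] by (auto simp: pre_def C_def)
      ultimately show False using ne P Q by metis
    qed
    then have "\<phi> x \<in> ?A'" using x unfolding C_def by blast
    then show ?thesis by (rule phi_A'[OF x])
  qed
qed

end

section \<open>The fraction field of the pullback\<close>

lemma (in domain) Frac_cases:
  assumes "x \<in> carrier (Frac R)"
  obtains a s where "a \<in> carrier R" "s \<in> carrier R - {\<zero>}" "x = loc_frac R (carrier R - {\<zero>}) a s"
  using assms by (auto simp: Frac_def localization_def fractions_def)

lemma (in domain) Frac_frac_closed: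
  assumes "a \<in> carrier R" "s \<in> carrier R - {\<zero>}"
  shows "loc_frac R (carrier R - {\<zero>}) a s \<in> carrier (Frac R)"
  using assms by (auto simp: Frac_def localization_def fractions_def)

lemma (in domain) Frac_frac_mult:
  assumes "a \<in> carrier R" "s \<in> carrier R - {\<zero>}" "b \<in> carrier R" "t \<in> carrier R - {\<zero>}"
  shows "loc_frac R (carrier R - {\<zero>}) a s \<otimes>\<^bsub>Frac R\<^esub> loc_frac R (carrier R - {\<zero>}) b t =
    loc_frac R (carrier R - {\<zero>}) (a \<otimes> b) (s \<otimes> t)"
  unfolding Frac_def by (rule loc_frac_mult[OF nonzero_submonoid assms])

lemma (in domain) Frac_frac_add:
  assumes "a \<in> carrier R" "s \<in> carrier R - {\<zero>}" "b \<in> carrier R" "t \<in> carrier R - {\<zero>}"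
  shows "loc_frac R (carrier R - {\<zero>}) a s \<oplus>\<^bsub>Frac R\<^esub> loc_frac R (carrier R - {\<zero>}) b t =
    loc_frac R (carrier R - {\<zero>}) (a \<otimes> t \<oplus> b \<otimes> s) (s \<otimes> t)"
  unfolding Frac_def by (rule loc_frac_add[OF nonzero_submonoid assms])

lemma (in domain) Frac_domain: "domain (Frac R)"
proof (intro domain.intro domain_axioms.intro)
  let ?f = "loc_frac R (carrier R - {\<zero>})"
  show "cring (Frac R)" unfolding Frac_def by (rule localization_cring[OF nonzero_submonoid])
  have one: "\<one>\<^bsub>Frac R\<^esub> = ?f \<one> \<one>" and zero: "\<zero>\<^bsub>Frac R\<^esub> = ?f \<zero> \<one>"
    by (simp_all add: Frac_def localization_def)
  show "\<one>\<^bsub>Frac R\<^esub> \<noteq> \<zero>\<^bsub>Frac R\<^esub>" unfolding one zero by (simp add: Frac_frac_eq_iff)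
  fix x y
  assume xy: "x \<otimes>\<^bsub>Frac R\<^esub> y = \<zero>\<^bsub>Frac R\<^esub>" and x: "x \<in> carrier (Frac R)" and y: "y \<in> carrier (Frac R)"
  from x obtain a s where a: "a \<in> carrier R" "s \<in> carrier R - {\<zero>}" "x = ?f a s" by (rule Frac_cases)
  from y obtain b t where b: "b \<in> carrier R" "t \<in> carrier R - {\<zero>}" "y = ?f b t" by (rule Frac_cases)
  have "?f (a \<otimes> b) (s \<otimes> t) = ?f \<zero> \<one>"
    using xy a b by (simp add: zero Frac_frac_mult)
  then have "a \<otimes> b = \<zero>" using a b by (subst (asm) Frac_frac_eq_iff) (auto simp: integral_iff)
  then have "a = \<zero> \<or> b = \<zero>" using a b integral by simp
  moreover have "?f \<zero> u = \<zero>\<^bsub>Frac R\<^esub>" if "u \<in> carrier R - {\<zero>}" for u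
    unfolding zero using that by (subst Frac_frac_eq_iff) auto
  ultimately show "x = \<zero>\<^bsub>Frac R\<^esub> \<or> y = \<zero>\<^bsub>Frac R\<^esub>" using a b by blast
qed

text \<open>Rewrites a set of fractions as solutions of \<open>x t = a\<close>, the shape in which
  \<open>overring_eq_localization\<close> describes \<open>L\<close>.\<close>

lemma (in domain) loc_at_eq:
  assumes P: "P \<in> Spec R"
  shows "loc_at R P = {x \<in> carrier (Frac R). \<exists>a\<in>carrier R. \<exists>t\<in>carrier R. t \<notin> P \<and>
    x \<otimes>\<^bsub>Frac R\<^esub> loc_frac R (carrier R - {\<zero>}) t \<one> = loc_frac R (carrier R - {\<zero>}) a \<one>}"
    (is "_ = ?X")
proof -
  let ?f = "loc_frac R (carrier R - {\<zero>})"
  have z: "\<zero> \<in> P" using P by (simp add: Spec_iff)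
  have iff: "?f b u \<otimes>\<^bsub>Frac R\<^esub> ?f t \<one> = ?f a \<one> \<longleftrightarrow> ?f b u = ?f a t"
    if "b \<in> carrier R" "u \<in> carrier R - {\<zero>}" "a \<in> carrier R" "t \<in> carrier R" "t \<notin> P" for a b t u
  proof -
    have "t \<noteq> \<zero>" using z that by auto
    then show ?thesis using that by (simp add: Frac_frac_mult Frac_frac_eq_iff)
  qed
  have loc: "x \<in> loc_at R P \<longleftrightarrow> (\<exists>a\<in>carrier R. \<exists>t\<in>carrier R. t \<notin> P \<and> x = ?f a t)" for x
    by (auto simp: loc_at_def fractions_def)
  show ?thesis
  proof (rule Set.set_eqI)
    fix x
    show "x \<in> loc_at R P \<longleftrightarrow> x \<in> ?X"
    proof (cases "x \<in> carrier (Frac R)")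
      case True
      then obtain b u where b: "b \<in> carrier R" "u \<in> carrier R - {\<zero>}" "x = ?f b u" by (rule Frac_cases)
      have "x \<in> loc_at R P \<longleftrightarrow> (\<exists>a\<in>carrier R. \<exists>t\<in>carrier R. t \<notin> P \<and>
          x \<otimes>\<^bsub>Frac R\<^esub> ?f t \<one> = ?f a \<one>)"
        unfolding loc b(3) by (intro bex_cong conj_cong refl) (rule iff[OF b(1,2), symmetric])
      then show ?thesis using True by simp
    next
      case False
      have "?f a t \<in> carrier (Frac R)" if "a \<in> carrier R" "t \<in> carrier R" "t \<notin> P" for a t
        using Frac_frac_closed[of a t] that z by auto
      then have "x \<notin> loc_at R P" using False unfolding loc by metis
      then show ?thesis using False by simp
    qed
  qed
qed

section \<open>Consequences of height at least two\<close>

lemma (in domain) not_subset_Spec1: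
  assumes J: "ideal_height R J \<ge> 2" and q: "q \<in> Spec1 R"
  shows "\<not> J \<subseteq> q"
proof
  assume "J \<subseteq> q"
  then have "ideal_height R J \<le> prime_height R q"
    using Spec1_Spec[OF q] unfolding ideal_height_def by (intro Inf_lower) auto
  with J have "2 \<le> prime_height R q" by (rule order_trans)
  then show False using q by (simp add: Spec1_def one_enat_def numeral_eq_enat)
qed

text \<open>The zero prime has height 0, as a smaller prime would still have to contain zero. This
  supplies the nonzero element of \<open>J\<close> through which \<open>S\<close> embeds in the
  fraction field of the pullback.\<close>

lemma (in domain) height_ge_2_nonzero:
  assumes J: "ideal_height R J \<ge> 2"
  shows "\<not> J \<subseteq> {\<zero>}"
proof
  assume "J \<subseteq> {\<zero>}"
  then have "ideal_height R J \<le> prime_height R {\<zero>}"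
    using zero_Spec unfolding ideal_height_def by (intro Inf_lower) auto
  moreover have "prime_height R {\<zero>} \<le> 0"
    unfolding prime_height_def
  proof (rule Sup_least, clarify)
    fix n :: nat and c :: "nat \<Rightarrow> 'a set"
    assume c: "\<forall>i\<le>n. c i \<in> Spec R" "\<forall>i<n. c i \<subset> c (Suc i)" "c n = {\<zero>}"
    show "enat n \<le> 0"
    proof (cases n)
      case (Suc k)
      then have "c k \<subset> {\<zero>}" "\<zero> \<in> c k" using c by (auto simp: Spec_iff)
      then show ?thesis by blast
    qed (simp add: zero_enat_def)
  qed
  ultimately have "(2::enat) \<le> 0" using J by (meson order_trans)
  then show False by simp
qed

section \<open>Perinormality of the pullback\<close>

theorem theorem3p5:
  fixes S :: "('a, 'm) ring_scheme" and J :: "'a set" and A :: "'a set set" and n :: nat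
  assumes "generalized_Krull_domain S"
    and "ideal J S"
    and "n \<ge> 2"
    and "card (minimal_primes_over S J) = n"
    and "ideal_height S J \<ge> 2"
    and "subring A (S Quot J)"
    and "integral_extension A (S Quot J)"
    and "fragile A (S Quot J)"
  shows "perinormal (S\<lparr>carrier := pullback S J A\<rparr>)"
proof -
  interpret S: domain S using assms(1) by (simp add: generalized_Krull_domain_def)
  interpret J: ideal J S by (rule assms(2))
  define R where "R = pullback S J A"
  let ?R = "S\<lparr>carrier := R\<rparr>"
  interpret \<pi>: ring_hom_cring S "S Quot J" "(+>\<^bsub>S\<^esub>) J"
    by (rule J.rcos_ring_hom_cring[OF S.is_cring])
  have R_iff: "s \<in> R \<longleftrightarrow> s \<in> carrier S \<and> J +>\<^bsub>S\<^esub> s \<in> A" for s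
    by (simp add: R_def pullback_def)
  note A = subringE[OF assms(6)]
  have R: "subring R S"
    by (rule S.subringI) (use A in \<open>auto simp: R_iff\<close>)
  have RS: "r \<in> carrier S" if "r \<in> R" for r using that by (simp add: R_iff)
  have JR: "J \<subseteq> R"
  proof
    fix j assume j: "j \<in> J"
    have "\<zero>\<^bsub>S Quot J\<^esub> = J" by (simp only: FactRing_def ring.simps)
    then have "J +>\<^bsub>S\<^esub> j \<in> A" using A(2) S.a_rcos_zero[OF assms(2) j] by metis
    then show "j \<in> R" using J.Icarr[OF j] R_iff by metis
  qed
  obtain j where j: "j \<in> J" "j \<noteq> \<zero>\<^bsub>S\<^esub>" using S.height_ge_2_nonzero[OF assms(5)] by blast
  have jR: "j \<in> R" "j \<in> carrier S" using j JR J.Icarr by auto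
  have sj: "s \<otimes>\<^bsub>S\<^esub> j \<in> R" if "s \<in> carrier S" for s using J.I_l_closed[OF j(1) that] JR by blast
  interpret R: domain ?R
    using S.subring_is_domain[OF R] .
  have R_ops: "a \<otimes>\<^bsub>S\<^esub> b \<in> R" "a \<oplus>\<^bsub>S\<^esub> b \<in> R" if "a \<in> R" "b \<in> R" for a b
    using that subringE(6,7)[OF R] by auto
  have one_R: "\<one>\<^bsub>S\<^esub> \<in> R" by (rule subringE(3)[OF R])
  let ?K = "Frac ?R" and ?f = "loc_frac ?R (R - {\<zero>\<^bsub>S\<^esub>})"
  interpret K: domain ?K by (rule R.Frac_domain)
  note feq = R.Frac_frac_eq_iff[simplified] and fmult = R.Frac_frac_mult[simplified]
    and fadd = R.Frac_frac_add[simplified]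
  \<comment> \<open>Multiplication by \<open>j\<close> sends \<open>S\<close> into
    \<open>J \<subseteq> R\<close>, so \<open>s\<close> can be written as the fraction
    \<open>s j / j\<close> over \<open>R\<close>. On \<open>R\<close> this is the usual
    embedding.\<close>
  define \<sigma> where "\<sigma> s = ?f (s \<otimes>\<^bsub>S\<^esub> j) j" for s
  have sigma_R: "\<sigma> r = ?f r \<one>\<^bsub>S\<^esub>" if "r \<in> R" for r
    unfolding \<sigma>_def using that jR j one_R sj RS by (subst feq) auto
  have hom: "\<sigma> \<in> ring_hom S ?K"
  proof (rule ring_hom_memI)
    fix s assume s: "s \<in> carrier S"
    show "\<sigma> s \<in> carrier ?K"
      unfolding \<sigma>_def using R.Frac_frac_closed sj[OF s] jR j by simp
    fix t assume t: "t \<in> carrier S"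
    show "\<sigma> (s \<otimes>\<^bsub>S\<^esub> t) = \<sigma> s \<otimes>\<^bsub>?K\<^esub> \<sigma> t"
    proof -
      have "s \<otimes>\<^bsub>S\<^esub> t \<otimes>\<^bsub>S\<^esub> j \<otimes>\<^bsub>S\<^esub> (j \<otimes>\<^bsub>S\<^esub> j) = s \<otimes>\<^bsub>S\<^esub> j \<otimes>\<^bsub>S\<^esub> (t \<otimes>\<^bsub>S\<^esub> j) \<otimes>\<^bsub>S\<^esub> j"
        using s t jR by (simp add: S.m_ac)
      then show ?thesis
        unfolding \<sigma>_def using s t sj jR j R_ops
        by (subst fmult, simp_all, subst feq) (simp_all add: S.integral_iff)
    qed
    show "\<sigma> (s \<oplus>\<^bsub>S\<^esub> t) = \<sigma> s \<oplus>\<^bsub>?K\<^esub> \<sigma> t"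
    proof -
      have "(s \<oplus>\<^bsub>S\<^esub> t) \<otimes>\<^bsub>S\<^esub> j \<otimes>\<^bsub>S\<^esub> (j \<otimes>\<^bsub>S\<^esub> j) =
          (s \<otimes>\<^bsub>S\<^esub> j \<otimes>\<^bsub>S\<^esub> j \<oplus>\<^bsub>S\<^esub> t \<otimes>\<^bsub>S\<^esub> j \<otimes>\<^bsub>S\<^esub> j) \<otimes>\<^bsub>S\<^esub> j"
        using s t jR by (simp add: S.m_ac S.l_distr S.r_distr)
      then show ?thesis
        unfolding \<sigma>_def using s t sj jR j R_ops
        by (subst fadd, simp_all, subst feq) (simp_all add: S.integral_iff)
    qed
  next
    show "\<sigma> \<one>\<^bsub>S\<^esub> = \<one>\<^bsub>?K\<^esub>" using sigma_R[OF one_R] by (simp add: Frac_def localization_def)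
  qed
  have inj: "inj_on \<sigma> (carrier S)"
  proof (rule inj_onI)
    fix s t assume st: "s \<in> carrier S" "t \<in> carrier S" and "\<sigma> s = \<sigma> t"
    then have "s \<otimes>\<^bsub>S\<^esub> j \<otimes>\<^bsub>S\<^esub> j = t \<otimes>\<^bsub>S\<^esub> j \<otimes>\<^bsub>S\<^esub> j"
      unfolding \<sigma>_def using sj jR j by (subst (asm) feq) auto
    then show "s = t" using st jR j by (simp add: S.m_rcancel)
  qed
  have frac: "\<exists>a\<in>R. \<exists>b\<in>R - {\<zero>\<^bsub>S\<^esub>}. x \<otimes>\<^bsub>?K\<^esub> \<sigma> b = \<sigma> a" if x: "x \<in> carrier ?K" for x
  proof -
    obtain a b where ab: "a \<in> R" "b \<in> R - {\<zero>\<^bsub>S\<^esub>}" "x = ?f a b"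
      using R.Frac_cases[OF x] by auto
    have "?f a b \<otimes>\<^bsub>?K\<^esub> ?f b \<one>\<^bsub>S\<^esub> = ?f a \<one>\<^bsub>S\<^esub>"
      using ab one_R R_ops RS by (subst fmult, simp_all, subst feq) auto
    then show ?thesis using ab sigma_R by auto
  qed
  have in_Frac: "in_Frac ?R = \<sigma> ` R"
    using sigma_R by (auto simp: in_Frac_def fractions_def)
  have "\<exists>P\<in>Spec ?R. L = loc_at ?R P"
    if L: "overring ?R L" and loc: "local_ring (?K\<lparr>carrier := L\<rparr>)"
      and gd: "going_down (in_Frac ?R) (?K\<lparr>carrier := L\<rparr>)" for L
  proof -
    have subL: "subring L ?K" and RL: "\<sigma> ` R \<subseteq> L" using L in_Frac by (auto simp: overring_def)
    have gd': "going_down_overring S ?K \<sigma> R J L"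
      by (intro going_down_overring.intro going_down_overring_axioms.intro S.domain_axioms
          K.domain_axioms assms(1,2) hom inj R JR S.not_subset_Spec1[OF assms(5)] frac subL RL
          gd[unfolded in_Frac])
    note \<sigma>_simps = going_down_overring.sigma_simps[OF gd']
    interpret L: cring "?K\<lparr>carrier := L\<rparr>" by (rule K.subring_cring[OF subL])
    obtain m where m: "m \<in> Spec (?K\<lparr>carrier := L\<rparr>)"
      and unit: "\<And>x. x \<in> L \<Longrightarrow> x \<notin> m \<Longrightarrow> \<exists>y\<in>L. x \<otimes>\<^bsub>?K\<^esub> y = \<one>\<^bsub>?K\<^esub>"
      using L.local_ring_prime_of_nonunits[OF loc] by auto
    note m' = m[unfolded K.Spec_subring_iff[OF subL]]
    \<comment> \<open>The prime at which \<open>R\<close> is localized is the contraction of the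
      maximal ideal of \<open>L\<close>.\<close>
    let ?P = "{r \<in> R. \<sigma> r \<in> m}"
    have P: "?P \<in> Spec ?R"
      unfolding S.Spec_subring_iff[OF R]
      using m' subringE(2,3)[OF R] R_ops RL RS \<sigma>_simps by (simp add: subset_iff)
    have "L = {x \<in> carrier ?K. \<exists>a\<in>R. \<exists>t\<in>R. \<sigma> t \<notin> m \<and> x \<otimes>\<^bsub>?K\<^esub> \<sigma> t = \<sigma> a}"
      using m unit assms(6) R_def assms(7,8)
      by (rule going_down_overring.overring_eq_localization[OF gd'])
    also have "\<dots> = loc_at ?R ?P"
      unfolding R.loc_at_eq[OF P] using sigma_R by auto
    finally show ?thesis using P by blast
  qed
  then show ?thesis
    unfolding perinormal_def R_def[symmetric] using R.domain_axioms by blast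
qed

end
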